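(* Let $0<\alpha<2$, let $(E,\mathcal E,\nu)$ be a standard Lebesgue space, with $E$ equipped with a metric $\rho$, and let $E\times\mathbb R$ be endowed with the product topology and with the measure $m(dx,du)=\nu(dx)\,du$. Let $G:E\times\mathbb R\to\mathbb R$ be a measurable function such that for every $t\in\mathbb R$ the function $G_t(x,u)=G(x,t+u)-G(x,u)$ belongs to $L^\alpha(E\times\mathbb R,m)$, and let $\{X_t\}_{t\in\mathbb R}$ be an S$\alpha$S process with $$\{X_t\}_{t\in\mathbb R}\stackrel{d}{=}\Big\{\int_E\int_{\mathbb R}\big(G(x,t+u)-G(x,u)\big)\,M_{\alpha,+}(dx,du)\Big\}_{t\in\mathbb R},$$ where $M_{\alpha,+}$ is an S$\alpha$S random measure with control measure $m$. Suppose there exists a closed set $\mathcal N\subset E\times\mathbb R$ with $m(\mathcal N)=0$ such that $G$ is continuous at every $(x,u)\in\mathcal N^c:=(E\times\mathbb R)\setminus\mathcal N$ with respect to the product topology. Then $\{X_t\}_{t\in\mathbb R}$ is max-associable if and only if there exist real-valued functions $f,c$ on $E$ and sets $A_x\subset\mathbb R$, $x\in E$, such that $$G(x,u)=f(x)\mathbf 1_{A_x}(u)+c(x)\quad\text{for all }(x,u)\in\mathcal N^c.$$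
   Context: $\stackrel{d}{=}$ between processes means equality of finite-dimensional distributions; $L^\alpha_+$ denotes the nonnegative functions in $L^\alpha$; $\mathbf 1_A$ is the indicator of $A$. For a $\sigma$-finite measure space $(S,\mu)$, an index set $T$ and $\{f_t\}_{t\in T}\subset L^\alpha(S,\mu)$, the process of stable integrals $\{\int_S f_t\,dM_{\alpha,+}\}_{t\in T}$, with $M_{\alpha,+}$ an S$\alpha$S random measure with control measure $\mu$, is the S$\alpha$S (symmetric $\alpha$-stable) process $\{X_t\}$ whose finite-dimensional distributions are determined by $$\mathbb E\exp\Big\{-i\sum_{j=1}^n a_jX_{t_j}\Big\}=\exp\Big\{-\int_S\Big|\sum_{j=1}^n a_jf_{t_j}\Big|^\alpha d\mu\Big\},\quad a_j\in\mathbb R,\ t_j\in T,\ n\in\mathbb N.$$ For $\{f_t\}_{t\in T}\subset L^\alpha_+(S,\mu)$, the process of extremal integrals $\{{}^{e}\!\!\int_S f_t\,dM_{\alpha,\vee}\}_{t\in T}$, with $M_{\alpha,\vee}$ an $\alpha$-Fréchet random sup-measure with control measure $\mu$, is the $\alpha$-Fréchet process $\{Y_t\}$ whose finite-dimensional distributions are $$\mathbb P(Y_{t_1}\le a_1,\dots,Y_{t_n}\le a_n)=\exp\Big\{-\int_S\Big(\bigvee_{j=1}^n f_{t_j}/a_j\Big)^\alpha d\mu\Big\},\quad a_j>0,\ t_j\in T,\ n\in\mathbb N.$$ An S$\alpha$S process $\{X_t\}_{t\in T}$ and an $\alpha$-Fréchet process $\{Y_t\}_{t\in T}$ are associated if there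 exist a $\sigma$-finite measure space $(S,\mu)$ and $\{g_t\}_{t\in T}\subset L^\alpha_+(S,\mu)$ with $\{X_t\}\stackrel{d}{=}\{\int_S g_t\,dM_{\alpha,+}\}$ and $\{Y_t\}\stackrel{d}{=}\{{}^{e}\!\!\int_S g_t\,dM_{\alpha,\vee}\}$. An S$\alpha$S process is max-associable if there is an $\alpha$-Fréchet process associated with it, i.e. if it has a spectral representation by nonnegative functions.
   Formalization: Adds that no nonempty open subset of N^c is m-null; else false, e.g. E=[0,1], ν=δ_0, G=1_{[0,1]}(u)+xu, N=[0,1]×{0,1}. In max-associability, (S,μ) and the probability space of Y are taken on the path space of real functions on T, an equivalent form. *)

theory Defs
  imports "HOL-Probability.Probability"
begin

text \<open>A measurable space is standard Borel if its sigma-algebra is the Borel sigma-algebra of some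
  Polish topology on the underlying set; a standard Lebesgue space carries in addition a
  sigma-finite measure.\<close>

definition standard_lebesgue_space :: "'a measure \<Rightarrow> bool" where
  "standard_lebesgue_space M \<longleftrightarrow>
     sigma_finite_measure M \<and>
     (\<exists>T. topspace T = space M \<and> completely_metrizable_space T \<and> second_countable T \<and>
          sets M = sigma_sets (space M) {U. openin T U})"

text \<open>The library has no \<open>L\<^sup>\<alpha>\<close> space for \<open>\<alpha> < 1\<close>. Elements are functions, not classes modulo
  null sets.\<close>

definition L_space :: "real \<Rightarrow> 's measure \<Rightarrow> ('s \<Rightarrow> real) set" where
  "L_space \<alpha> M = {f \<in> borel_measurable M. integrable M (\<lambda>s. \<bar>f s\<bar> powr \<alpha>)}"

definition L_space_nonneg :: "real \<Rightarrow> 's measure \<Rightarrow> ('s \<Rightarrow> real) set" where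
  "L_space_nonneg \<alpha> M = {f \<in> L_space \<alpha> M. \<forall>s\<in>space M. 0 \<le> f s}"

definition real_process :: "'w measure \<Rightarrow> ('t \<Rightarrow> 'w \<Rightarrow> real) \<Rightarrow> bool" where
  "real_process P X \<longleftrightarrow> prob_space P \<and> (\<forall>t. X t \<in> borel_measurable P)"

text \<open>All finite linear combinations are symmetric stable; the scale \<open>\<sigma> = 0\<close> is the point mass
  at 0. Tuples of indices may contain repetitions, here and below.\<close>

definition sas_process :: "real \<Rightarrow> 'w measure \<Rightarrow> ('t \<Rightarrow> 'w \<Rightarrow> real) \<Rightarrow> bool" where
  "sas_process \<alpha> P X \<longleftrightarrow> real_process P X \<and>
     (\<forall>(n::nat) (a::nat \<Rightarrow> real) (t::nat \<Rightarrow> 't). \<exists>\<sigma>\<ge>0. \<forall>\<theta>.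
        char (distr P borel (\<lambda>w. \<Sum>j<n. a j * X (t j) w)) \<theta> =
          complex_of_real (exp (- (\<sigma> powr \<alpha> * \<bar>\<theta>\<bar> powr \<alpha>))))"

text \<open>All finite max-linear combinations are \<open>\<alpha>\<close>-Frechet. The scale \<open>\<sigma> = 0\<close> must be the point
  mass at 0, which the distribution function on the positive half-line alone does not force; hence
  the separate nonnegativity requirement.\<close>

definition frechet_process :: "real \<Rightarrow> 'w measure \<Rightarrow> ('t \<Rightarrow> 'w \<Rightarrow> real) \<Rightarrow> bool" where
  "frechet_process \<alpha> P Y \<longleftrightarrow> real_process P Y \<and>
     (\<forall>t. AE w in P. 0 \<le> Y t w) \<and>
     (\<forall>(n::nat) (a::nat \<Rightarrow> real) (t::nat \<Rightarrow> 't). 0 < n \<longrightarrow> (\<forall>j<n. 0 < a j) \<longrightarrow>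
        (\<exists>\<sigma>\<ge>0. \<forall>x>0.
           measure P {w \<in> space P. (MAX j\<in>{..<n}. a j * Y (t j) w) \<le> x} =
             exp (- (\<sigma> powr \<alpha> * x powr (- \<alpha>)))))"

text \<open>Equality in finite-dimensional distributions with the process of stable integrals
  \<open>\<integral> f\<^sub>t dM\<close>, where \<open>M\<close> is a symmetric stable random measure with control measure \<open>\<mu>\<close>: the latter's
  finite-dimensional distributions are the ones with these characteristic functions.\<close>

definition eq_fdd_stable_integrals ::
    "real \<Rightarrow> 'w measure \<Rightarrow> ('t \<Rightarrow> 'w \<Rightarrow> real) \<Rightarrow> 's measure \<Rightarrow> ('t \<Rightarrow> 's \<Rightarrow> real) \<Rightarrow> bool" where
  "eq_fdd_stable_integrals \<alpha> P X \<mu> f \<longleftrightarrow>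
     (\<forall>(n::nat) (a::nat \<Rightarrow> real) (t::nat \<Rightarrow> 't).
        (LINT w|P. exp (- (\<i> * complex_of_real (\<Sum>j<n. a j * X (t j) w)))) =
          complex_of_real (exp (- (LINT s|\<mu>. \<bar>\<Sum>j<n. a j * f (t j) s\<bar> powr \<alpha>))))"

text \<open>The same for the process of extremal integrals with respect to an \<open>\<alpha>\<close>-Frechet random
  sup-measure with control measure \<open>\<mu>\<close>.\<close>

definition eq_fdd_extremal_integrals ::
    "real \<Rightarrow> 'w measure \<Rightarrow> ('t \<Rightarrow> 'w \<Rightarrow> real) \<Rightarrow> 's measure \<Rightarrow> ('t \<Rightarrow> 's \<Rightarrow> real) \<Rightarrow> bool" where
  "eq_fdd_extremal_integrals \<alpha> P Y \<mu> f \<longleftrightarrow>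
     (\<forall>(n::nat) (a::nat \<Rightarrow> real) (t::nat \<Rightarrow> 't). 0 < n \<longrightarrow> (\<forall>j<n. 0 < a j) \<longrightarrow>
        measure P {w \<in> space P. \<forall>j<n. Y (t j) w \<le> a j} =
          exp (- (LINT s|\<mu>. (MAX j\<in>{..<n}. f (t j) s / a j) powr \<alpha>)))"

text \<open>HOL cannot quantify over the type carrying the space \<open>(S,\<mu>)\<close>, so it is taken on the path
  space \<open>'t \<Rightarrow> real\<close>, with an arbitrary sigma-algebra. This loses nothing: given \<open>g\<^sub>t\<close> on any
  sigma-finite \<open>(S,\<mu>)\<close> with \<open>\<mu> \<noteq> 0\<close>, choose a measurable \<open>h > 0\<close> with \<open>\<integral> h d\<mu> = 1\<close>; the
  functions \<open>k\<^sub>t = h\<^bsup>-1/\<alpha>\<^esup> g\<^sub>t\<close> on the probability space \<open>(S, h d\<mu>)\<close> give the same stable and extremal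
  integrals, and so do the coordinate functions (replaced by their positive parts) under the image
  of \<open>h d\<mu>\<close> by \<open>s \<mapsto> (k\<^sub>t(s))\<^sub>t\<close>.\<close>

definition associated ::
    "real \<Rightarrow> 'w measure \<Rightarrow> ('t \<Rightarrow> 'w \<Rightarrow> real) \<Rightarrow> 'v measure \<Rightarrow> ('t \<Rightarrow> 'v \<Rightarrow> real) \<Rightarrow> bool" where
  "associated \<alpha> P X Q Y \<longleftrightarrow>
     sas_process \<alpha> P X \<and> frechet_process \<alpha> Q Y \<and>
     (\<exists>(\<mu> :: ('t \<Rightarrow> real) measure) g. sigma_finite_measure \<mu> \<and>
        (\<forall>t. g t \<in> L_space_nonneg \<alpha> \<mu>) \<and>
        eq_fdd_stable_integrals \<alpha> P X \<mu> g \<and>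
        eq_fdd_extremal_integrals \<alpha> Q Y \<mu> g)"

text \<open>Likewise, every process indexed by \<open>'t\<close> has a version on the path space \<open>'t \<Rightarrow> real\<close>.\<close>

definition max_associable :: "real \<Rightarrow> 'w measure \<Rightarrow> ('t \<Rightarrow> 'w \<Rightarrow> real) \<Rightarrow> bool" where
  "max_associable \<alpha> P X \<longleftrightarrow>
     (\<exists>(Q :: ('t \<Rightarrow> real) measure) Y. associated \<alpha> P X Q Y)"

end

theory Submission
  imports Defs
begin

text \<open>
Write \<open>f\<^sub>t\<close> for the increment \<open>(x, u) \<mapsto> G (x, t + u) - G (x, u)\<close>. The proof passes through a criterion
that concerns arbitrary representations, \<open>max_associable_iff_same_sign\<close>: a process of stable
integrals of functions \<open>f\<^sub>t\<close> is max-associable if and only if any two of the \<open>f\<^sub>t\<close> have weakly the same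
sign almost everywhere.

If they do, then \<open>\<bar>\<Sum> a\<^sub>j f\<^bsub>t\<^sub>j\<^esub>\<bar> = \<bar>\<Sum> a\<^sub>j \<bar>f\<^bsub>t\<^sub>j\<^esub>\<bar>\<bar>\<close> almost everywhere, so the \<open>\<bar>f\<^sub>t\<bar>\<close> represent the same process.
What remains is to move the control measure to the path space (\<open>path_space_representation\<close>) and to
show that the associated Frechet process exists (\<open>frechet_process_exists\<close>); it is the supremum of de
Haan's series \<open>\<gamma>\<^sub>i\<^bsup>-1/\<alpha>\<^esup> k\<^sub>t(s\<^sub>i)\<close> over the points \<open>(s\<^sub>i, \<gamma>\<^sub>i)\<close> of a Poisson process.

Conversely, let nonnegative \<open>g\<^sub>t\<close> represent the process. For each pair of indices the norms
\<open>\<integral> \<bar>a f\<^sub>s + b f\<^sub>t\<bar>\<^sup>\<alpha>\<close> are then the corresponding norms of \<open>g\<^sub>s, g\<^sub>t\<close>. A Mellin transform in \<open>b\<close>, at the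
exponent \<open>\<alpha>/2\<close>, turns the part of the norm that is even in \<open>b\<close>, less its pure powers, into a nonzero multiple of
\<open>\<integral> \<bar>f\<^sub>s f\<^sub>t\<bar>\<^bsup>\<alpha>/2\<^esup>\<close> and the odd part into a nonzero multiple of \<open>\<integral> sgn (f\<^sub>s f\<^sub>t) \<bar>f\<^sub>s f\<^sub>t\<bar>\<^bsup>\<alpha>/2\<^esup>\<close>. For \<open>g\<^sub>s, g\<^sub>t \<ge> 0\<close> these
two integrals agree; hence they agree for \<open>f\<^sub>s, f\<^sub>t\<close>, which forces \<open>f\<^sub>s f\<^sub>t \<ge> 0\<close>
(\<open>nonneg_product_from_stable_norms\<close>). The general uniqueness theorem for spectral measures is thereby
replaced by two explicit integrals.

For the increments of \<open>G\<close>, continuity off \<open>N\<close> makes the almost-everywhere condition hold at all points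
of \<open>- N\<close>: the differences \<open>G (x, v) - G (x, u)\<close> and \<open>G (x, w) - G (x, u)\<close> never have opposite signs. This
says that no value on a section of \<open>- N\<close> lies strictly between two others, that is, that each section
carries at most two values (\<open>two_valued_iff_increments_same_sign\<close>).
\<close>

section \<open>Mellin transforms of stable norms\<close>

text \<open>
The abstract form of the two kernels used below. With \<open>z = b * y\<close>, homogeneity turns the integral of
\<open>\<bar>K x (b * y)\<bar>\<close> against \<open>b\<^bsup>-\<alpha>/2-1\<^esup> db\<close> over \<open>b > 0\<close> into a constant times \<open>\<bar>x * y\<bar>\<^bsup>\<alpha>/2\<^esup>\<close>. The remaining
conditions make the constant positive and finite: \<open>small\<close> gives integrability near \<open>0\<close> because
\<open>\<alpha>/2 < 1\<close>, and the symmetry \<open>b \<mapsto> 1/b\<close> carries it over to infinity.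
\<close>

locale mellin_kernel =
  fixes \<alpha> :: real and K :: "real \<Rightarrow> real \<Rightarrow> real" and C :: real
  assumes exponent: "0 < \<alpha>" "\<alpha> < 2"
    and measurable_K [measurable]: "case_prod K \<in> borel_measurable borel"
    and even_modulus: "\<bar>K (abs x) (abs z)\<bar> = \<bar>K x z\<bar>"
    and symmetric_modulus: "\<bar>K x z\<bar> = \<bar>K z x\<bar>"
    and homogeneous: "0 < l \<Longrightarrow> K (l * x) (l * z) = l powr \<alpha> * K x z"
    and vanishes_on_axis: "K x 0 = 0"
    and nonzero: "0 < b \<Longrightarrow> K 1 b \<noteq> 0"
    and small: "0 < b \<Longrightarrow> b \<le> 1 \<Longrightarrow> \<bar>K 1 b\<bar> \<le> C * (b + b powr \<alpha>)"

text \<open>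
Up to terms that do not mix \<open>x\<close> and \<open>z\<close>, these are minus twice the even part and twice the odd part of
\<open>\<bar>x + z\<bar>\<^sup>\<alpha>\<close> as a function of \<open>z\<close>. The pure powers make the even kernel
vanish on both axes, which the Mellin integral needs at \<open>b = 0\<close> and at infinity.
\<close>

definition even_kernel :: "real \<Rightarrow> real \<Rightarrow> real \<Rightarrow> real" where
  "even_kernel \<alpha> x z = 2 * \<bar>x\<bar> powr \<alpha> + 2 * \<bar>z\<bar> powr \<alpha> - \<bar>x + z\<bar> powr \<alpha> - \<bar>x - z\<bar> powr \<alpha>"

definition odd_kernel :: "real \<Rightarrow> real \<Rightarrow> real \<Rightarrow> real" where
  "odd_kernel \<alpha> x z = \<bar>x + z\<bar> powr \<alpha> - \<bar>x - z\<bar> powr \<alpha>"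

lemma powr_strict_subadditive:
  fixes p x y :: real
  assumes "0 < p" "p < 1" "0 < x" "0 < y"
  shows "(x + y) powr p < x powr p + y powr p"
proof -
  have *: "u * (x + y) powr (p - 1) < u powr p" if "0 < u" "u < x + y" for u
  proof -
    have "(x + y) powr (p - 1) < u powr (p - 1)"
      using that assms by (intro powr_less_mono2_neg) auto
    then have "u * (x + y) powr (p - 1) < u * u powr (p - 1)"
      using that by simp
    also have "u * u powr (p - 1) = u powr p"
      using that powr_mult_base[of u "p - 1"] by simp
    finally show ?thesis .
  qed
  have "(x + y) powr p = (x + y) * (x + y) powr (p - 1)"
    using assms powr_mult_base[of "x + y" "p - 1"] by simp
  also have "\<dots> = x * (x + y) powr (p - 1) + y * (x + y) powr (p - 1)"
    by (simp add: algebra_simps)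
  also have "\<dots> < x powr p + y powr p"
    using *[of x] *[of y] assms by auto
  finally show ?thesis .
qed

text \<open>
Concavity of \<open>w \<mapsto> w\<^sup>p\<close>, as the tangent inequality at the midpoint, which is Young's inequality.
\<close>

lemma powr_mean_le:
  fixes p u v :: real
  assumes "0 < p" "p < 1" "0 \<le> u" "0 \<le> v" "0 < u + v"
  shows "u powr p + v powr p \<le> 2 * ((u + v) / 2) powr p"
proof -
  define m where "m = (u + v) / 2"
  have m: "0 < m" using assms m_def by auto
  have tangent: "w powr p * m powr (1 - p) \<le> p * w + (1 - p) * m" if "0 \<le> w" for w
    using that m assms Youngs_inequality_0[of p "1 - p" w m] by (cases "w = 0") auto
  have "(u powr p + v powr p) * m powr (1 - p) \<le> (p * u + (1 - p) * m) + (p * v + (1 - p) * m)"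
    using tangent[of u] tangent[of v] assms by (simp add: algebra_simps)
  also have "\<dots> = 2 * m" by (simp add: m_def field_simps)
  also have "\<dots> = 2 * m powr p * m powr (1 - p)"
    using m by (simp add: powr_add[symmetric])
  finally show ?thesis using m by (simp add: m_def)
qed

text \<open>
Here \<open>\<alpha> < 2\<close> enters: for \<open>\<alpha> = 2\<close> the parallelogram law makes the kernel zero. With \<open>p = \<alpha>/2 < 1\<close>, concavity of
the \<open>p\<close>-th power bounds the mixed terms by \<open>2 (x\<^sup>2 + z\<^sup>2)\<^sup>p\<close>, and its strict subadditivity bounds that by
\<open>2 x\<^bsup>2p\<^esup> + 2 z\<^bsup>2p\<^esup>\<close>.
\<close>

lemma even_kernel_pos:
  assumes "0 < \<alpha>" "\<alpha> < 2" "x \<noteq> 0" "z \<noteq> 0"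
  shows "0 < even_kernel \<alpha> x z"
proof -
  have sq: "\<bar>w\<bar> powr \<alpha> = (w\<^sup>2) powr (\<alpha> / 2)" for w :: real
  proof -
    have "(w\<^sup>2) powr (\<alpha> / 2) = (\<bar>w\<bar> powr 2) powr (\<alpha> / 2)" by (simp add: powr_numeral)
    also have "\<dots> = \<bar>w\<bar> powr (2 * (\<alpha> / 2))" by (rule powr_powr)
    finally show ?thesis by simp
  qed
  have "\<bar>x + z\<bar> powr \<alpha> + \<bar>x - z\<bar> powr \<alpha> \<le> 2 * (((x + z)\<^sup>2 + (x - z)\<^sup>2) / 2) powr (\<alpha> / 2)"
    unfolding sq using assms
    by (intro powr_mean_le) (auto simp: sum_power2_gt_zero_iff)
  also have "((x + z)\<^sup>2 + (x - z)\<^sup>2) / 2 = x\<^sup>2 + z\<^sup>2"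
    by (simp add: power2_eq_square algebra_simps)
  also have "(x\<^sup>2 + z\<^sup>2) powr (\<alpha> / 2) < (x\<^sup>2) powr (\<alpha> / 2) + (z\<^sup>2) powr (\<alpha> / 2)"
    using assms by (intro powr_strict_subadditive) auto
  finally show ?thesis by (simp add: even_kernel_def sq)
qed

text \<open>
Since \<open>\<alpha> < 2\<close>, the \<open>\<alpha>\<close>-th powers of \<open>1 - b\<close> and \<open>1 + b\<close> compare with the squares, which yields bounds linear in \<open>b\<close>.
\<close>

lemma one_minus_powr_ge:
  fixes b :: real
  assumes "0 \<le> b" "b \<le> 1" "0 < \<alpha>" "\<alpha> < 2"
  shows "1 - 2 * b \<le> (1 - b) powr \<alpha>"
proof -
  have "1 - 2 * b \<le> (1 - b)\<^sup>2" by (simp add: power2_eq_square algebra_simps)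
  also have "\<dots> = (1 - b) powr 2" using assms by (simp add: powr_numeral)
  also have "\<dots> \<le> (1 - b) powr \<alpha>"
    using assms by (intro powr_mono') auto
  finally show ?thesis .
qed

lemma one_plus_powr_le: 
  fixes b :: real
  assumes "0 \<le> b" "b \<le> 1" "0 < \<alpha>" "\<alpha> < 2"
  shows "(1 + b) powr \<alpha> \<le> 1 + 3 * b"
proof -
  have "(1 + b) powr \<alpha> \<le> (1 + b) powr 2"
    using assms by (intro powr_mono) auto
  also have "\<dots> = (1 + b)\<^sup>2" using assms by (simp add: powr_numeral)
  also have "\<dots> \<le> 1 + 3 * b"
    using assms mult_mono[of b 1 b b] by (simp add: power2_eq_square algebra_simps)
  finally show ?thesis .
qed

lemma mellin_kernel_even:
  assumes "0 < \<alpha>" "\<alpha> < 2"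
  shows "mellin_kernel \<alpha> (even_kernel \<alpha>) 5"
proof
  show "case_prod (even_kernel \<alpha>) \<in> borel_measurable borel"
    unfolding even_kernel_def borel_prod[symmetric] by measurable
  show "\<bar>even_kernel \<alpha> \<bar>x\<bar> \<bar>z\<bar>\<bar> = \<bar>even_kernel \<alpha> x z\<bar>" for x z
  proof -
    have "{\<bar>\<bar>x\<bar> + \<bar>z\<bar>\<bar>, \<bar>\<bar>x\<bar> - \<bar>z\<bar>\<bar>} = {\<bar>x + z\<bar>, \<bar>x - z\<bar>}" by (auto simp: abs_if)
    then show ?thesis by (auto simp: even_kernel_def doubleton_eq_iff algebra_simps)
  qed
  show "\<bar>even_kernel \<alpha> x z\<bar> = \<bar>even_kernel \<alpha> z x\<bar>" for x z
    by (simp add: even_kernel_def abs_minus_commute algebra_simps)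
  show "even_kernel \<alpha> (l * x) (l * z) = l powr \<alpha> * even_kernel \<alpha> x z" if "0 < l" for l x z
    using that
    by (simp add: even_kernel_def abs_mult powr_mult distrib_left[symmetric] right_diff_distrib[symmetric] del: distrib_left_numeral)
       (simp add: algebra_simps)
  show "even_kernel \<alpha> x 0 = 0" for x by (simp add: even_kernel_def)
  show "even_kernel \<alpha> 1 b \<noteq> 0" if "0 < b" for b
    using even_kernel_pos[OF assms, of 1 b] that by simp
  show "\<bar>even_kernel \<alpha> 1 b\<bar> \<le> 5 * (b + b powr \<alpha>)" if b: "0 < b" "b \<le> 1" for b
  proof -
    have "1 \<le> (1 + b) powr \<alpha>" using b assms by (intro ge_one_powr_ge_zero) auto
    moreover have "even_kernel \<alpha> 1 b = 2 + 2 * b powr \<alpha> - (1 + b) powr \<alpha> - (1 - b) powr \<alpha>"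
      using b by (simp add: even_kernel_def)
    moreover have "1 - 2 * b \<le> (1 - b) powr \<alpha>" using b assms by (intro one_minus_powr_ge) auto
    moreover have "0 \<le> b powr \<alpha>" by simp
    ultimately have "even_kernel \<alpha> 1 b \<le> 5 * (b + b powr \<alpha>)"
      unfolding distrib_left using b by linarith
    then show ?thesis using even_kernel_pos[OF assms, of 1 b] b by simp
  qed
qed fact+

lemma odd_kernel_pos:
  assumes "0 < \<alpha>" "0 < x * z"
  shows "0 < odd_kernel \<alpha> x z"
proof -
  have "\<bar>x - z\<bar> < \<bar>x + z\<bar>" using assms(2) by (auto simp: abs_if zero_less_mult_iff)
  then have "\<bar>x - z\<bar> powr \<alpha> < \<bar>x + z\<bar> powr \<alpha>"
    using assms(1) by (intro powr_less_mono2) auto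
  then show ?thesis by (simp add: odd_kernel_def)
qed

lemma odd_kernel_minus: "odd_kernel \<alpha> x (- z) = - odd_kernel \<alpha> x z"
  by (simp add: odd_kernel_def)

lemma odd_kernel_axes: "x * z = 0 \<Longrightarrow> odd_kernel \<alpha> x z = 0"
  by (auto simp: odd_kernel_def)

lemma mellin_kernel_odd:
  assumes "0 < \<alpha>" "\<alpha> < 2"
  shows "mellin_kernel \<alpha> (odd_kernel \<alpha>) 5"
proof
  show "case_prod (odd_kernel \<alpha>) \<in> borel_measurable borel"
    unfolding odd_kernel_def borel_prod[symmetric] by measurable
  show "\<bar>odd_kernel \<alpha> \<bar>x\<bar> \<bar>z\<bar>\<bar> = \<bar>odd_kernel \<alpha> x z\<bar>" for x z
  proof -
    have "{\<bar>\<bar>x\<bar> + \<bar>z\<bar>\<bar>, \<bar>\<bar>x\<bar> - \<bar>z\<bar>\<bar>} = {\<bar>x + z\<bar>, \<bar>x - z\<bar>}" by (auto simp: abs_if)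
    then show ?thesis by (auto simp: odd_kernel_def doubleton_eq_iff abs_minus_commute)
  qed
  show "\<bar>odd_kernel \<alpha> x z\<bar> = \<bar>odd_kernel \<alpha> z x\<bar>" for x z
    by (simp add: odd_kernel_def abs_minus_commute algebra_simps)
  show "odd_kernel \<alpha> (l * x) (l * z) = l powr \<alpha> * odd_kernel \<alpha> x z" if "0 < l" for l x z
    using that
    by (simp add: odd_kernel_def abs_mult powr_mult distrib_left[symmetric] right_diff_distrib[symmetric])
  show "odd_kernel \<alpha> x 0 = 0" for x by (simp add: odd_kernel_def)
  show "odd_kernel \<alpha> 1 b \<noteq> 0" if "0 < b" for b
    using odd_kernel_pos[of \<alpha> 1 b] assms that by simp
  show "\<bar>odd_kernel \<alpha> 1 b\<bar> \<le> 5 * (b + b powr \<alpha>)" if b: "0 < b" "b \<le> 1" for b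
  proof -
    have "odd_kernel \<alpha> 1 b \<le> 5 * b"
      using one_minus_powr_ge[OF _ _ assms, of b] one_plus_powr_le[OF _ _ assms, of b] b
      by (simp add: odd_kernel_def)
    also have "\<dots> \<le> 5 * (b + b powr \<alpha>)" by simp
    finally show ?thesis using odd_kernel_pos[of \<alpha> 1 b] assms b by simp
  qed
qed fact+

context mellin_kernel
begin

definition mellin_weight :: "real \<Rightarrow> real" where
  "mellin_weight b = indicator {0<..} b * b powr (- \<alpha> / 2 - 1)"

definition mellin_constant :: ennreal where
  "mellin_constant = (\<integral>\<^sup>+b. ennreal (mellin_weight b * \<bar>K 1 b\<bar>) \<partial>lborel)"

lemma measurable_section [measurable]: "K x \<in> borel_measurable borel"
  using measurable_K unfolding borel_prod[symmetric] by measurable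

lemma measurable_mellin_weight [measurable]: "mellin_weight \<in> borel_measurable borel"
  unfolding mellin_weight_def by measurable

text \<open>
The substitution \<open>b \<mapsto> (\<bar>x\<bar> / \<bar>y\<bar>) b\<close> reduces the kernel to \<open>K 1 b\<close>; at the exponent \<open>\<alpha>/2\<close> the two variables
then contribute the same power.
\<close>

lemma mellin_integral:
  "(\<integral>\<^sup>+b. ennreal (mellin_weight b * \<bar>K x (b * y)\<bar>) \<partial>lborel) =
     mellin_constant * ennreal (\<bar>x * y\<bar> powr (\<alpha> / 2))"
proof (cases "x = 0 \<or> y = 0")
  case True
  have "K 0 z = 0" for z using symmetric_modulus[of 0 z] vanishes_on_axis by simp
  then show ?thesis using True vanishes_on_axis exponent by auto
next
  case False
  define X Y where "X = \<bar>x\<bar>" and "Y = \<bar>y\<bar>"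
  have XY: "0 < X" "0 < Y" using False by (auto simp: X_def Y_def)
  have "(\<integral>\<^sup>+b. ennreal (mellin_weight b * \<bar>K x (b * y)\<bar>) \<partial>lborel) =
        ennreal \<bar>X / Y\<bar> * (\<integral>\<^sup>+b. ennreal (mellin_weight (0 + X / Y * b) * \<bar>K x ((0 + X / Y * b) * y)\<bar>) \<partial>lborel)"
    using XY by (intro nn_integral_real_affine) auto
  also have "\<dots> = (\<integral>\<^sup>+b. ennreal (X / Y) * ennreal (mellin_weight (X / Y * b) * \<bar>K x (X / Y * b * y)\<bar>) \<partial>lborel)"
    using XY by (subst nn_integral_cmult[symmetric]) auto
  also have "\<dots> = (\<integral>\<^sup>+b. ennreal ((X * Y) powr (\<alpha> / 2)) * ennreal (mellin_weight b * \<bar>K 1 b\<bar>) \<partial>lborel)"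
  proof (intro nn_integral_cong)
    fix b :: real
    show "ennreal (X / Y) * ennreal (mellin_weight (X / Y * b) * \<bar>K x (X / Y * b * y)\<bar>) =
          ennreal ((X * Y) powr (\<alpha> / 2)) * ennreal (mellin_weight b * \<bar>K 1 b\<bar>)"
    proof (cases "0 < b")
      case True
      have "\<bar>K x (X / Y * b * y)\<bar> = \<bar>K X (X / Y * b * Y)\<bar>"
        using XY True by (subst even_modulus[symmetric]) (simp add: X_def Y_def abs_mult)
      also have "X / Y * b * Y = X * b" using XY by simp
      also have "\<bar>K X (X * b)\<bar> = X powr \<alpha> * \<bar>K 1 b\<bar>"
        using homogeneous[of X 1 b] XY by (simp add: abs_mult)
      finally have 1: "\<bar>K x (X / Y * b * y)\<bar> = X powr \<alpha> * \<bar>K 1 b\<bar>" .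
      have 2: "mellin_weight (X / Y * b) = (X / Y) powr (- \<alpha> / 2 - 1) * mellin_weight b"
        using XY True powr_mult[of "X / Y" b] by (simp add: mellin_weight_def)
      have "X / Y * (X / Y) powr (- \<alpha> / 2 - 1) * X powr \<alpha> = (X / Y) powr (- \<alpha> / 2) * X powr \<alpha>"
        using XY powr_mult_base[of "X / Y" "- \<alpha> / 2 - 1"] by simp
      also have "\<dots> = (X * Y) powr (\<alpha> / 2)"
        using XY by (simp add: powr_divide powr_mult powr_minus field_simps powr_add[symmetric])
      finally have 3: "X / Y * (X / Y) powr (- \<alpha> / 2 - 1) * X powr \<alpha> = (X * Y) powr (\<alpha> / 2)" .
      have "X / Y * (mellin_weight (X / Y * b) * \<bar>K x (X / Y * b * y)\<bar>) =
        (X / Y * (X / Y) powr (- \<alpha> / 2 - 1) * X powr \<alpha>) * (mellin_weight b * \<bar>K 1 b\<bar>)"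
        unfolding 1 2 by (simp only: mult_ac)
      then show ?thesis unfolding 3 using XY
        by (subst (1 2) ennreal_mult[symmetric]) (auto simp: mellin_weight_def)
    next
      case False
      then have "mellin_weight b = 0" "mellin_weight (X / Y * b) = 0"
        using XY by (auto simp: mellin_weight_def indicator_def zero_less_mult_iff zero_less_divide_iff)
      then show ?thesis by simp
    qed
  qed
  also have "\<dots> = mellin_constant * ennreal (\<bar>x * y\<bar> powr (\<alpha> / 2))"
    by (subst nn_integral_cmult) (auto simp: mellin_constant_def X_def Y_def abs_mult mult.commute)
  finally show ?thesis .
qed

lemma mellin_constant_pos: "0 < mellin_constant"
proof -
  have "mellin_constant \<noteq> 0"
  proof
    assume "mellin_constant = 0"
    then have "AE b in lborel. mellin_weight b * \<bar>K 1 b\<bar> \<le> 0"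
      unfolding mellin_constant_def by (subst (asm) nn_integral_0_iff_AE) (auto simp: ennreal_eq_0_iff)
    moreover have "0 < mellin_weight b * \<bar>K 1 b\<bar>" if "b \<in> {0<..1}" for b
      using that nonzero[of b] by (simp add: mellin_weight_def)
    ultimately have "AE b in lborel. b \<notin> {0<..1::real}"
      by (auto elim!: eventually_mono simp: not_le[symmetric])
    then have "{0<..1::real} \<in> null_sets lborel"
      by (subst AE_iff_null_sets) auto
    then show False by (simp add: null_sets_def)
  qed
  then show ?thesis by (simp add: zero_less_iff_neq_zero)
qed

lemma mellin_constant_finite: "mellin_constant < \<infinity>"
proof -
  define D where "D = max C 0"
  have small': "\<bar>K 1 b\<bar> \<le> D * (b + b powr \<alpha>)" if "0 < b" "b \<le> 1" for b
  proof -
    have "C * (b + b powr \<alpha>) \<le> D * (b + b powr \<alpha>)"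
      using that by (intro mult_right_mono) (auto simp: D_def)
    with small[OF that] show ?thesis by linarith
  qed
  have large: "\<bar>K 1 b\<bar> \<le> D * (b powr (\<alpha> - 1) + 1)" if "1 \<le> b" for b
  proof -
    have "\<bar>K 1 b\<bar> = \<bar>K b 1\<bar>" by (rule symmetric_modulus)
    also have "\<dots> = b powr \<alpha> * \<bar>K 1 (1 / b)\<bar>"
      using homogeneous[of b 1 "1 / b"] that by (simp add: abs_mult)
    also have "\<dots> \<le> b powr \<alpha> * (D * (1 / b + (1 / b) powr \<alpha>))"
      using that by (intro mult_left_mono small') auto
    also have "\<dots> = D * (b powr (\<alpha> - 1) + 1)"
      using that by (simp add: powr_diff powr_divide field_simps)
    finally show ?thesis .
  qed
  \<comment> \<open>The product of the bound and the weight on \<open>(0, 1]\<close>, and its counterpart under \<open>b \<mapsto> 1/b\<close>.\<close>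
  define near where "near b = D * (b powr (- \<alpha> / 2) + b powr (\<alpha> / 2 - 1))" for b
  define far where "far b = D * (b powr (\<alpha> / 2 - 2) + b powr (- \<alpha> / 2 - 1))" for b
  have D: "0 \<le> D" by (simp add: D_def)
  have bound: "mellin_weight b * \<bar>K 1 b\<bar> \<le> indicator {0..1} b * near b + indicator {1..} b * far b" for b
  proof -
    consider "b \<le> 0" | "0 < b" "b \<le> 1" | "1 < b" by linarith
    then show ?thesis
    proof cases
      case 1
      then show ?thesis using D by (auto simp: mellin_weight_def near_def far_def indicator_def)
    next
      case 2
      have "b powr (- \<alpha> / 2 - 1) * \<bar>K 1 b\<bar> \<le> b powr (- \<alpha> / 2 - 1) * (D * (b powr 1 + b powr \<alpha>))"
        using 2 small'[of b] by (intro mult_left_mono) auto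
      also have "\<dots> = near b"
        unfolding near_def by (simp only: distrib_left mult.left_commute[of _ D] powr_add[symmetric]) simp
      finally show ?thesis using 2 D
        by (auto simp: mellin_weight_def far_def indicator_def)
    next
      case 3
      have "b powr (- \<alpha> / 2 - 1) * \<bar>K 1 b\<bar> \<le> b powr (- \<alpha> / 2 - 1) * (D * (b powr (\<alpha> - 1) + b powr 0))"
        using 3 large[of b] by (intro mult_left_mono) auto
      also have "\<dots> = far b"
        unfolding far_def by (simp only: distrib_left mult.left_commute[of _ D] powr_add[symmetric]) simp
      finally show ?thesis using 3
        by (auto simp: mellin_weight_def indicator_def)
    qed
  qed
  have near: "(near has_integral D * (1 powr (- \<alpha> / 2 + 1) / (- \<alpha> / 2 + 1) + 1 powr (\<alpha> / 2 - 1 + 1) / (\<alpha> / 2 - 1 + 1))) {0..1}"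
    unfolding near_def using exponent
    by (intro has_integral_mult_right has_integral_add has_integral_powr_from_0) auto
  have far: "(far has_integral D * (- (1 powr (\<alpha> / 2 - 2 + 1)) / (\<alpha> / 2 - 2 + 1) + - (1 powr (- \<alpha> / 2 - 1 + 1)) / (- \<alpha> / 2 - 1 + 1))) {1..}"
    unfolding far_def using exponent
    by (intro has_integral_mult_right has_integral_add has_integral_powr_to_inf) auto
  have [measurable]: "near \<in> borel_measurable borel" "far \<in> borel_measurable borel"
    unfolding near_def far_def by measurable
  have nonneg: "0 \<le> near b" "0 \<le> far b" for b using D by (auto simp: near_def far_def)
  have "mellin_constant \<le> (\<integral>\<^sup>+b. ennreal (indicator {0..1} b * near b) + ennreal (indicator {1..} b * far b) \<partial>lborel)"
    unfolding mellin_constant_def using nonneg bound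
    by (intro nn_integral_mono) (simp add: ennreal_plus[symmetric] del: ennreal_plus)
  also have "\<dots> = (\<integral>\<^sup>+b. ennreal (indicator {0..1} b * near b) \<partial>lborel) + (\<integral>\<^sup>+b. ennreal (indicator {1..} b * far b) \<partial>lborel)"
    by (rule nn_integral_add) auto
  also have "\<dots> < \<infinity>"
    unfolding nn_integral_has_integral_lebesgue[OF nonneg(1) near] nn_integral_has_integral_lebesgue[OF nonneg(2) far]
    by simp
  finally show ?thesis .
qed


lemma measurable_K_compose [measurable (raw)]:
  assumes [measurable]: "f \<in> borel_measurable M" "g \<in> borel_measurable M"
  shows "(\<lambda>s. K (f s) (g s)) \<in> borel_measurable M"
  using measurable_compose[of "\<lambda>s. (f s, g s)" M borel, OF _ measurable_K] by simp

text \<open>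
The set \<open>B\<close> allows the odd kernel to be restricted to where \<open>f * g\<close> is positive. Taking absolute values
keeps all integrands nonnegative, so that Tonelli's theorem applies.
\<close>

lemma mellin_tonelli:
  assumes "sigma_finite_measure M"
    and [measurable]: "f \<in> borel_measurable M" "g \<in> borel_measurable M" "B \<in> sets M"
  shows "(\<integral>\<^sup>+b. ennreal (mellin_weight b) * (\<integral>\<^sup>+s. ennreal \<bar>K (f s) (b * g s)\<bar> * indicator B s \<partial>M) \<partial>lborel) =
    mellin_constant * (\<integral>\<^sup>+s. ennreal (\<bar>f s * g s\<bar> powr (\<alpha> / 2)) * indicator B s \<partial>M)"
proof -
  interpret M: sigma_finite_measure M by fact
  interpret pair_sigma_finite M lborel ..
  have "(\<integral>\<^sup>+b. ennreal (mellin_weight b) * (\<integral>\<^sup>+s. ennreal \<bar>K (f s) (b * g s)\<bar> * indicator B s \<partial>M) \<partial>lborel) =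
    (\<integral>\<^sup>+b. \<integral>\<^sup>+s. ennreal (mellin_weight b) * (ennreal \<bar>K (f s) (b * g s)\<bar> * indicator B s) \<partial>M \<partial>lborel)"
    by (intro nn_integral_cong nn_integral_cmult[symmetric]) measurable
  also have "\<dots> = (\<integral>\<^sup>+s. \<integral>\<^sup>+b. ennreal (mellin_weight b) * (ennreal \<bar>K (f s) (b * g s)\<bar> * indicator B s) \<partial>lborel \<partial>M)"
    by (rule Fubini') measurable
  also have "\<dots> = (\<integral>\<^sup>+s. mellin_constant * (ennreal (\<bar>f s * g s\<bar> powr (\<alpha> / 2)) * indicator B s) \<partial>M)"
  proof (intro nn_integral_cong)
    fix s
    have "(\<integral>\<^sup>+b. ennreal (mellin_weight b) * (ennreal \<bar>K (f s) (b * g s)\<bar> * indicator B s) \<partial>lborel) =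
      (\<integral>\<^sup>+b. ennreal (mellin_weight b * \<bar>K (f s) (b * g s)\<bar>) * indicator B s \<partial>lborel)"
      by (intro nn_integral_cong) (simp add: ennreal_mult mellin_weight_def mult.assoc)
    also have "\<dots> = mellin_constant * (ennreal (\<bar>f s * g s\<bar> powr (\<alpha> / 2)) * indicator B s)"
      by (subst nn_integral_multc) (auto simp: mellin_integral mult.assoc)
    finally show "(\<integral>\<^sup>+b. ennreal (mellin_weight b) * (ennreal \<bar>K (f s) (b * g s)\<bar> * indicator B s) \<partial>lborel) =
      mellin_constant * (ennreal (\<bar>f s * g s\<bar> powr (\<alpha> / 2)) * indicator B s)" .
  qed
  also have "\<dots> = mellin_constant * (\<integral>\<^sup>+s. ennreal (\<bar>f s * g s\<bar> powr (\<alpha> / 2)) * indicator B s \<partial>M)"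
    by (rule nn_integral_cmult) measurable
  finally show ?thesis .
qed

end

lemma powr_add_le_max:
  fixes x y p :: real
  assumes "0 < p"
  shows "\<bar>x + y\<bar> powr p \<le> 2 powr p * (\<bar>x\<bar> powr p + \<bar>y\<bar> powr p)"
proof -
  have "\<bar>x + y\<bar> powr p \<le> (2 * max \<bar>x\<bar> \<bar>y\<bar>) powr p"
    using assms by (intro powr_mono2) auto
  also have "\<dots> = 2 powr p * max \<bar>x\<bar> \<bar>y\<bar> powr p"
    by (simp add: powr_mult)
  also have "\<dots> \<le> 2 powr p * (\<bar>x\<bar> powr p + \<bar>y\<bar> powr p)"
    by (intro mult_left_mono) (auto simp: max_def)
  finally show ?thesis .
qed

lemma L_space_measurable: "f \<in> L_space \<alpha> M \<Longrightarrow> f \<in> borel_measurable M"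
  by (simp add: L_space_def)

lemma L_space_integrable: "f \<in> L_space \<alpha> M \<Longrightarrow> integrable M (\<lambda>s. \<bar>f s\<bar> powr \<alpha>)"
  by (simp add: L_space_def)

lemma L_space_cmult:
  assumes "f \<in> L_space \<alpha> M"
  shows "(\<lambda>s. a * f s) \<in> L_space \<alpha> M"
  using assms by (auto simp: L_space_def abs_mult powr_mult)

lemma L_space_add:
  assumes "f \<in> L_space \<alpha> M" "g \<in> L_space \<alpha> M" "0 < \<alpha>"
  shows "(\<lambda>s. f s + g s) \<in> L_space \<alpha> M"
proof -
  note [measurable] = assms(1,2)[THEN L_space_measurable]
  have "integrable M (\<lambda>s. 2 powr \<alpha> * (\<bar>f s\<bar> powr \<alpha> + \<bar>g s\<bar> powr \<alpha>))"
    using assms(1,2)[THEN L_space_integrable] by auto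
  then have "integrable M (\<lambda>s. \<bar>f s + g s\<bar> powr \<alpha>)"
    by (rule Bochner_Integration.integrable_bound) (use powr_add_le_max[OF assms(3)] in auto)
  then show ?thesis by (auto simp: L_space_def)
qed

lemma L_space_nonnegD:
  assumes "f \<in> L_space_nonneg \<alpha> M"
  shows "f \<in> L_space \<alpha> M" "s \<in> space M \<Longrightarrow> 0 \<le> f s"
  using assms by (auto simp: L_space_nonneg_def)

text \<open>
The even kernel gives \<open>\<integral> \<bar>f1 f2\<bar>\<^bsup>\<alpha>/2\<^esup> = \<integral> (g1 g2)\<^bsup>\<alpha>/2\<^esup>\<close>. The odd kernel has the sign of \<open>f1 f2\<close> for \<open>b > 0\<close>, and
that of \<open>g1 g2 \<ge> 0\<close> on the other side; dropping the part where it is negative gives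
\<open>\<integral> (g1 g2)\<^bsup>\<alpha>/2\<^esup> \<le> \<integral>\<^bsub>f1 f2 > 0\<^esub> \<bar>f1 f2\<bar>\<^bsup>\<alpha>/2\<^esup>\<close>. Since these integrals are finite, \<open>{f1 f2 < 0}\<close> must be null.
\<close>

lemma nonneg_product_from_stable_norms:
  assumes \<alpha>: "0 < \<alpha>" "\<alpha> < 2"
    and sf: "sigma_finite_measure M" "sigma_finite_measure M'"
    and f: "f1 \<in> L_space \<alpha> M" "f2 \<in> L_space \<alpha> M"
    and g: "g1 \<in> L_space_nonneg \<alpha> M'" "g2 \<in> L_space_nonneg \<alpha> M'"
    and eq: "\<And>a b. (LINT s|M. \<bar>a * f1 s + b * f2 s\<bar> powr \<alpha>) = (LINT s|M'. \<bar>a * g1 s + b * g2 s\<bar> powr \<alpha>)"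
  shows "AE s in M. 0 \<le> f1 s * f2 s"
proof -
  interpret E: mellin_kernel \<alpha> "even_kernel \<alpha>" 5 by (rule mellin_kernel_even[OF \<alpha>])
  interpret O: mellin_kernel \<alpha> "odd_kernel \<alpha>" 5 by (rule mellin_kernel_odd[OF \<alpha>])
  note g' = g[THEN L_space_nonnegD(1)]
  note fm [measurable] = f[THEN L_space_measurable] and gm [measurable] = g'[THEN L_space_measurable]
  have intf: "integrable M (\<lambda>s. \<bar>a * f1 s + b * f2 s\<bar> powr \<alpha>)" for a b
    using f \<alpha> by (intro L_space_integrable L_space_add L_space_cmult)
  have intg: "integrable M' (\<lambda>s. \<bar>a * g1 s + b * g2 s\<bar> powr \<alpha>)" for a b
    using g' \<alpha> by (intro L_space_integrable L_space_add L_space_cmult)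
  have even_nonneg: "0 \<le> even_kernel \<alpha> x z" for x z
    using even_kernel_pos[OF \<alpha>, of x z] by (cases "x = 0 \<or> z = 0") (auto simp: even_kernel_def)
  \<comment> \<open>The trivial coefficients put every term in the form to which the hypothesis on norms applies.\<close>
  have even_expand: "even_kernel \<alpha> x (b * y) = 2 * \<bar>1 * x + 0 * y\<bar> powr \<alpha> + 2 * \<bar>0 * x + b * y\<bar> powr \<alpha>
      - \<bar>1 * x + b * y\<bar> powr \<alpha> - \<bar>1 * x + (- b) * y\<bar> powr \<alpha>" for x y b :: real
    by (simp add: even_kernel_def)
  have odd_expand: "odd_kernel \<alpha> x (b * y) = \<bar>1 * x + b * y\<bar> powr \<alpha> - \<bar>1 * x + (- b) * y\<bar> powr \<alpha>" for x y b :: real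
    by (simp add: odd_kernel_def)
  have even_int: "integrable M (\<lambda>s. even_kernel \<alpha> (f1 s) (b * f2 s))"
      "integrable M' (\<lambda>s. even_kernel \<alpha> (g1 s) (b * g2 s))" for b
    unfolding even_expand
    by (intro Bochner_Integration.integrable_diff Bochner_Integration.integrable_add integrable_mult_right intf intg)+
  have odd_int: "integrable M (\<lambda>s. odd_kernel \<alpha> (f1 s) (b * f2 s))"
      "integrable M' (\<lambda>s. odd_kernel \<alpha> (g1 s) (b * g2 s))" for b
    unfolding odd_expand by (intro Bochner_Integration.integrable_diff intf intg)+
  let ?I = "\<lambda>M f g B. \<integral>\<^sup>+s. ennreal (\<bar>f s * g s\<bar> powr (\<alpha> / 2)) * indicator B s \<partial>M"
  define B where "B = {s \<in> space M. 0 < f1 s * f2 s}"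
  have [measurable]: "B \<in> sets M" unfolding B_def by measurable

  have "(\<integral>\<^sup>+s. ennreal \<bar>even_kernel \<alpha> (f1 s) (b * f2 s)\<bar> * indicator (space M) s \<partial>M) =
        (\<integral>\<^sup>+s. ennreal \<bar>even_kernel \<alpha> (g1 s) (b * g2 s)\<bar> * indicator (space M') s \<partial>M')" for b
  proof -
    have "(\<integral>\<^sup>+s. ennreal \<bar>even_kernel \<alpha> (f1 s) (b * f2 s)\<bar> * indicator (space M) s \<partial>M) =
       (\<integral>\<^sup>+s. ennreal (even_kernel \<alpha> (f1 s) (b * f2 s)) \<partial>M)"
      using even_nonneg by (intro nn_integral_cong) auto
    also have "\<dots> = ennreal (LINT s|M. even_kernel \<alpha> (f1 s) (b * f2 s))"
      using even_nonneg even_int by (intro nn_integral_eq_integral) auto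
    also have "(LINT s|M. even_kernel \<alpha> (f1 s) (b * f2 s)) = (LINT s|M'. even_kernel \<alpha> (g1 s) (b * g2 s))"
      unfolding even_expand
      by (simp only: Bochner_Integration.integral_diff Bochner_Integration.integral_add integral_mult_right
          integral_mult_right_zero Bochner_Integration.integrable_diff Bochner_Integration.integrable_add
          integrable_mult_right intf intg eq)
    also have "ennreal \<dots> = (\<integral>\<^sup>+s. ennreal (even_kernel \<alpha> (g1 s) (b * g2 s)) \<partial>M')"
      using even_nonneg even_int by (intro nn_integral_eq_integral[symmetric]) auto
    also have "\<dots> = (\<integral>\<^sup>+s. ennreal \<bar>even_kernel \<alpha> (g1 s) (b * g2 s)\<bar> * indicator (space M') s \<partial>M')"
      using even_nonneg by (intro nn_integral_cong) auto
    finally show ?thesis .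
  qed
  then have "E.mellin_constant * ?I M f1 f2 (space M) = E.mellin_constant * ?I M' g1 g2 (space M')"
    by (simp only: E.mellin_tonelli[OF sf(1) fm sets.top, symmetric] E.mellin_tonelli[OF sf(2) gm sets.top, symmetric])
  then have total: "?I M f1 f2 (space M) = ?I M' g1 g2 (space M')"
    using E.mellin_constant_pos E.mellin_constant_finite by (auto simp: ennreal_mult_cancel_left)

  have "(\<integral>\<^sup>+s. ennreal \<bar>odd_kernel \<alpha> (g1 s) (b * g2 s)\<bar> * indicator (space M') s \<partial>M') \<le>
        (\<integral>\<^sup>+s. ennreal \<bar>odd_kernel \<alpha> (f1 s) (b * f2 s)\<bar> * indicator B s \<partial>M)" if "0 < b" for b
  proof -
    have nonneg: "0 \<le> odd_kernel \<alpha> (g1 s) (b * g2 s)" if "s \<in> space M'" for s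
    proof -
      have "0 \<le> g1 s * (b * g2 s)"
        using L_space_nonnegD(2)[OF g(1) that] L_space_nonnegD(2)[OF g(2) that] \<open>0 < b\<close> by simp
      then show ?thesis
        using odd_kernel_pos[OF \<alpha>(1)] odd_kernel_axes by (fastforce simp: order_le_less)
    qed
    have "(\<integral>\<^sup>+s. ennreal \<bar>odd_kernel \<alpha> (g1 s) (b * g2 s)\<bar> * indicator (space M') s \<partial>M') =
       (\<integral>\<^sup>+s. ennreal (odd_kernel \<alpha> (g1 s) (b * g2 s)) \<partial>M')"
      using nonneg by (intro nn_integral_cong) auto
    also have "\<dots> = ennreal (LINT s|M'. odd_kernel \<alpha> (g1 s) (b * g2 s))"
      using nonneg odd_int by (intro nn_integral_eq_integral) auto
    also have "(LINT s|M'. odd_kernel \<alpha> (g1 s) (b * g2 s)) = (LINT s|M. odd_kernel \<alpha> (f1 s) (b * f2 s))"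
      unfolding odd_expand by (simp only: Bochner_Integration.integral_diff intf intg eq)
    also have "ennreal \<dots> \<le> (\<integral>\<^sup>+s. ennreal (odd_kernel \<alpha> (f1 s) (b * f2 s)) \<partial>M)"
    proof -
      have "(LINT s|M. odd_kernel \<alpha> (f1 s) (b * f2 s)) \<le> (LINT s|M. max 0 (odd_kernel \<alpha> (f1 s) (b * f2 s)))"
        using odd_int by (intro integral_mono) auto
      also have "ennreal \<dots> = (\<integral>\<^sup>+s. ennreal (max 0 (odd_kernel \<alpha> (f1 s) (b * f2 s))) \<partial>M)"
        using odd_int by (intro nn_integral_eq_integral[symmetric]) auto
      also have "\<dots> = (\<integral>\<^sup>+s. ennreal (odd_kernel \<alpha> (f1 s) (b * f2 s)) \<partial>M)"
        by (intro nn_integral_cong) (auto simp: max_def ennreal_neg)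
      finally show ?thesis by (simp add: ennreal_leI)
    qed
    also have "\<dots> \<le> (\<integral>\<^sup>+s. ennreal \<bar>odd_kernel \<alpha> (f1 s) (b * f2 s)\<bar> * indicator B s \<partial>M)"
    proof (intro nn_integral_mono)
      fix s assume s: "s \<in> space M"
      have "odd_kernel \<alpha> (f1 s) (b * f2 s) \<le> 0" if "s \<notin> B"
      proof -
        have "0 \<le> f1 s * (b * (- f2 s))"
          using that s \<open>0 < b\<close> by (auto simp: B_def not_less mult_le_0_iff zero_le_mult_iff)
        then have "0 \<le> odd_kernel \<alpha> (f1 s) (b * (- f2 s))"
          using odd_kernel_pos[OF \<alpha>(1)] odd_kernel_axes by (fastforce simp: order_le_less)
        then show ?thesis by (simp add: odd_kernel_minus)
      qed
      then show "ennreal (odd_kernel \<alpha> (f1 s) (b * f2 s)) \<le> ennreal \<bar>odd_kernel \<alpha> (f1 s) (b * f2 s)\<bar> * indicator B s"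
        by (cases "s \<in> B") (auto simp: ennreal_neg intro: ennreal_leI)
    qed
    finally show ?thesis .
  qed
  then have "(\<integral>\<^sup>+b. ennreal (O.mellin_weight b) * (\<integral>\<^sup>+s. ennreal \<bar>odd_kernel \<alpha> (g1 s) (b * g2 s)\<bar> * indicator (space M') s \<partial>M') \<partial>lborel) \<le>
    (\<integral>\<^sup>+b. ennreal (O.mellin_weight b) * (\<integral>\<^sup>+s. ennreal \<bar>odd_kernel \<alpha> (f1 s) (b * f2 s)\<bar> * indicator B s \<partial>M) \<partial>lborel)"
    by (intro nn_integral_mono) (auto simp: O.mellin_weight_def indicator_def intro: mult_left_mono)
  then have "O.mellin_constant * ?I M' g1 g2 (space M') \<le> O.mellin_constant * ?I M f1 f2 B"
    by (simp only: O.mellin_tonelli[OF sf(1) fm \<open>B \<in> sets M\<close>] O.mellin_tonelli[OF sf(2) gm sets.top])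
  then have "?I M' g1 g2 (space M') \<le> ?I M f1 f2 B"
    using O.mellin_constant_pos O.mellin_constant_finite
    by (subst (asm) ennreal_mult_le_mult_iff) auto
  then have le: "?I M f1 f2 (space M) \<le> ?I M f1 f2 B" by (simp only: total)

  have finite: "?I M f1 f2 B < \<infinity>"
  proof -
    have prod_le: "\<bar>x * y\<bar> powr (\<alpha> / 2) \<le> \<bar>x\<bar> powr \<alpha> + \<bar>y\<bar> powr \<alpha>" for x y :: real
    proof -
      have "\<bar>x * y\<bar> powr (\<alpha> / 2) \<le> (max \<bar>x\<bar> \<bar>y\<bar> powr 2) powr (\<alpha> / 2)"
        using \<alpha> by (intro powr_mono2) (auto simp: powr_numeral power2_eq_square abs_mult intro: mult_mono)
      also have "\<dots> = max \<bar>x\<bar> \<bar>y\<bar> powr \<alpha>" unfolding powr_powr by simp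
      also have "\<dots> \<le> \<bar>x\<bar> powr \<alpha> + \<bar>y\<bar> powr \<alpha>" by (simp add: max_def)
      finally show ?thesis .
    qed
    have "?I M f1 f2 B \<le> (\<integral>\<^sup>+s. ennreal (\<bar>f1 s\<bar> powr \<alpha> + \<bar>f2 s\<bar> powr \<alpha>) \<partial>M)"
      using prod_le by (intro nn_integral_mono) (auto intro!: ennreal_leI simp: indicator_def simp del: ennreal_plus)
    also have "\<dots> < \<infinity>"
      using f[THEN L_space_integrable]
      by (subst nn_integral_eq_integral) auto
    finally show ?thesis .
  qed
  have "?I M f1 f2 (space M) = ?I M f1 f2 B + ?I M f1 f2 (space M - B)"
    by (subst nn_integral_add[symmetric]) (auto intro!: nn_integral_cong simp: indicator_def B_def)
  then have "?I M f1 f2 (space M - B) = 0"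
    using le finite ennreal_add_left_cancel_le[of "?I M f1 f2 B" _ 0] by (auto simp del: nn_integral_0_iff_AE)
  then have "AE s in M. ennreal (\<bar>f1 s * f2 s\<bar> powr (\<alpha> / 2)) * indicator (space M - B) s = 0"
    by (subst (asm) nn_integral_0_iff_AE) auto
  then show ?thesis
  proof (rule AE_mp, intro AE_I2 impI)
    fix s assume "s \<in> space M" "ennreal (\<bar>f1 s * f2 s\<bar> powr (\<alpha> / 2)) * indicator (space M - B) s = 0"
    then show "0 \<le> f1 s * f2 s"
      by (cases "s \<in> B") (auto simp: B_def ennreal_eq_0_iff powr_def split: if_splits)
  qed
qed

section \<open>Representation on the path space\<close>

text \<open>
For a positive density \<open>h\<close> of total mass one, replacing \<open>M\<close> by \<open>h dM\<close> and \<open>k t\<close> by \<open>h\<^bsup>-1/\<alpha>\<^esup> k t\<close> leaves all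
integrals of functions homogeneous of degree \<open>\<alpha>\<close> unchanged; the image under \<open>s \<mapsto> (h s)\<^bsup>-1/\<alpha>\<^esup> k t s\<close> then lives
on paths, with the coordinates as integrands. Positive parts are taken since the space of the image
measure contains all paths. The zero measure, which cannot be normalised, is treated separately.
\<close>

lemma path_space_representation:
  fixes k :: "'t \<Rightarrow> 's \<Rightarrow> real" and M :: "'s measure"
  assumes \<alpha>: "0 < \<alpha>" and sf: "sigma_finite_measure M"
    and k: "\<And>t. k t \<in> L_space_nonneg \<alpha> M"
  obtains D :: "('t \<Rightarrow> real) measure" and g where
    "prob_space D" "\<And>t. g t \<in> L_space_nonneg \<alpha> D"
    "\<And>(n::nat) (a::nat \<Rightarrow> real) (t::nat \<Rightarrow> 't).
       (LINT s|D. \<bar>\<Sum>j<n. a j * g (t j) s\<bar> powr \<alpha>) = (LINT s|M. \<bar>\<Sum>j<n. a j * k (t j) s\<bar> powr \<alpha>)"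
proof (cases "emeasure M (space M) = 0")
  case True
  let ?D = "return (\<Pi>\<^sub>M t\<in>(UNIV::'t set). (borel :: real measure)) (\<lambda>_. 0)"
  have "prob_space ?D" by (intro prob_space_return) (simp add: space_PiM)
  moreover have "(\<lambda>_. 0) \<in> L_space_nonneg \<alpha> ?D"
    by (simp add: L_space_nonneg_def L_space_def)
  moreover have "AE s in M. False"
    using True by (subst AE_iff_measurable[OF sets.top]) auto
  then have "(LINT s|M. f s) = 0" for f :: "'s \<Rightarrow> real"
    by (intro integral_eq_zero_AE) auto
  ultimately show thesis using that[of ?D "\<lambda>_ _. 0"] by simp
next
  case False
  interpret sigma_finite_measure M by fact
  obtain h0 :: "'s \<Rightarrow> real" where h0 [measurable]: "h0 \<in> borel_measurable M"
    and h0_pos: "\<And>s. 0 < h0 s" and h0_int: "integrable M h0"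
    using obtain_positive_integrable_function by metis
  define c where "c = (LINT s|M. h0 s)"
  have "c \<noteq> 0"
  proof
    assume "c = 0"
    then have "AE s in M. h0 s = 0"
      unfolding c_def using h0_pos h0_int
      by (subst (asm) integral_nonneg_eq_0_iff_AE) (auto simp: less_imp_le)
    then have "AE s in M. False" using h0_pos by (auto elim!: eventually_mono simp: less_le)
    then show False using False by (subst (asm) AE_iff_measurable[OF sets.top]) auto
  qed
  moreover have "0 \<le> c" unfolding c_def using h0_pos by (intro Bochner_Integration.integral_nonneg) (auto simp: less_imp_le)
  ultimately have c: "0 < c" by simp
  define h where "h s = h0 s / c" for s
  have [measurable]: "h \<in> borel_measurable M" unfolding h_def by measurable
  have h_pos: "0 < h s" for s using h0_pos c by (simp add: h_def)
  define N where "N = density M (\<lambda>s. ennreal (h s))"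
  have sets_N [measurable_cong]: "sets N = sets M" by (simp add: N_def)
  have "emeasure N (space N) = (\<integral>\<^sup>+s. ennreal (h s) \<partial>M)"
    by (simp add: N_def emeasure_density cong: nn_integral_cong)
  also have "\<dots> = ennreal (LINT s|M. h s)"
    using h0_int h_pos by (intro nn_integral_eq_integral) (auto simp: h_def less_imp_le)
  also have "(LINT s|M. h s) = 1" using c by (simp add: h_def c_def)
  finally interpret N: prob_space N by (intro prob_spaceI) simp
  have k_meas [measurable]: "k t \<in> borel_measurable M" for t
    using L_space_measurable[OF L_space_nonnegD(1)[OF k]] .
  define \<phi> where "\<phi> s t = h s powr (- 1 / \<alpha>) * k t s" for s t
  let ?P = "\<Pi>\<^sub>M t\<in>(UNIV::'t set). (borel :: real measure)"
  have [measurable]: "\<phi> \<in> N \<rightarrow>\<^sub>M ?P"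
    unfolding \<phi>_def by (intro measurable_PiM_single') (auto simp: space_PiM)
  define D where "D = distr N ?P \<phi>"
  have sets_D [measurable_cong]: "sets D = sets ?P" by (simp add: D_def)
  define g :: "'t \<Rightarrow> ('t \<Rightarrow> real) \<Rightarrow> real" where "g t \<omega> = max 0 (\<omega> t)" for t \<omega>
  have g_meas [measurable]: "g t \<in> borel_measurable ?P" for t
    unfolding g_def by measurable
  have g_\<phi>: "g t (\<phi> s) = h s powr (- 1 / \<alpha>) * k t s" if "s \<in> space M" for s t
    using L_space_nonnegD(2)[OF k that, of t] by (simp add: g_def \<phi>_def max_def)
  have pull: "h s * \<bar>\<Sum>j<n. a j * g (t j) (\<phi> s)\<bar> powr \<alpha> = \<bar>\<Sum>j<n. a j * k (t j) s\<bar> powr \<alpha>"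
    if "s \<in> space M" for s and n :: nat and a :: "nat \<Rightarrow> real" and t
  proof -
    have "(\<Sum>j<n. a j * g (t j) (\<phi> s)) = h s powr (- 1 / \<alpha>) * (\<Sum>j<n. a j * k (t j) s)"
      using that by (simp add: g_\<phi> sum_distrib_left mult_ac)
    then have "h s * \<bar>\<Sum>j<n. a j * g (t j) (\<phi> s)\<bar> powr \<alpha> =
      (h s * h s powr (- 1)) * \<bar>\<Sum>j<n. a j * k (t j) s\<bar> powr \<alpha>"
      using \<alpha> by (simp add: abs_mult powr_mult powr_powr)
    also have "h s * h s powr (- 1) = 1"
      using h_pos[of s] by (simp add: powr_minus)
    finally show ?thesis by simp
  qed
  have transfer: "(LINT s|D. \<bar>\<Sum>j<n. a j * g (t j) s\<bar> powr \<alpha>) = (LINT s|M. \<bar>\<Sum>j<n. a j * k (t j) s\<bar> powr \<alpha>)"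
    for n and a :: "nat \<Rightarrow> real" and t
  proof -
    have "(LINT s|D. \<bar>\<Sum>j<n. a j * g (t j) s\<bar> powr \<alpha>) = (LINT s|N. \<bar>\<Sum>j<n. a j * g (t j) (\<phi> s)\<bar> powr \<alpha>)"
      unfolding D_def by (rule integral_distr) measurable
    also have "\<dots> = (LINT s|M. h s * \<bar>\<Sum>j<n. a j * g (t j) (\<phi> s)\<bar> powr \<alpha>)"
      unfolding N_def using h_pos by (subst integral_density) (auto simp: less_imp_le)
    also have "\<dots> = (LINT s|M. \<bar>\<Sum>j<n. a j * k (t j) s\<bar> powr \<alpha>)"
      by (intro Bochner_Integration.integral_cong refl) (rule pull)
    finally show ?thesis .
  qed
  have "integrable D (\<lambda>\<omega>. \<bar>g t \<omega>\<bar> powr \<alpha>)" for t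
  proof -
    have "h s *\<^sub>R \<bar>g t (\<phi> s)\<bar> powr \<alpha> = \<bar>k t s\<bar> powr \<alpha>" if "s \<in> space M" for s
      using pull[OF that, of "\<lambda>_. 1" "\<lambda>_. t" 1] by simp
    then have "integrable M (\<lambda>s. h s *\<^sub>R \<bar>g t (\<phi> s)\<bar> powr \<alpha>)"
      using L_space_integrable[OF L_space_nonnegD(1)[OF k], of t]
      by (subst Bochner_Integration.integrable_cong[OF refl]) auto
    then have "integrable N (\<lambda>s. \<bar>g t (\<phi> s)\<bar> powr \<alpha>)"
      unfolding N_def using h_pos by (subst integrable_density) (auto simp: less_imp_le)
    then show ?thesis unfolding D_def by (subst integrable_distr_eq) auto
  qed
  then have "g t \<in> L_space_nonneg \<alpha> D" for t
    by (simp add: L_space_nonneg_def L_space_def) (simp add: g_def)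
  moreover have "prob_space D" unfolding D_def by (rule N.prob_space_distr) measurable
  ultimately show thesis using that transfer by blast
qed

section \<open>Existence of the Frechet process\<close>

lemma MAX_divide:
  fixes f :: "nat \<Rightarrow> real"
  assumes "0 < n" "0 < x"
  shows "(MAX j\<in>{..<n}. f j / x) = (MAX j\<in>{..<n}. f j) / x"
  using assms mono_Max_commute[of "\<lambda>y. y / x" "f ` {..<n}"]
  by (simp add: mono_def divide_right_mono image_image lessThan_empty_iff)

text \<open>
A max-linear combination has the law of an extremal integral of \<open>MAX j. a j * g (t j)\<close>, whose scale is the
\<open>\<alpha>\<close>-norm of that function.
\<close>

lemma frechet_process_of_extremal_integrals:
  assumes \<alpha>: "0 < \<alpha>" and process: "real_process P Y" "\<And>t. AE w in P. 0 \<le> Y t w"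
    and g: "\<And>t. g t \<in> L_space_nonneg \<alpha> \<mu>"
    and fdd: "eq_fdd_extremal_integrals \<alpha> P Y \<mu> g"
  shows "frechet_process \<alpha> P Y"
  unfolding frechet_process_def
proof (intro conjI allI impI)
  fix n :: nat and a :: "nat \<Rightarrow> real" and t
  assume n: "0 < n" and a: "\<forall>j<n. 0 < a j"
  define I where "I = (LINT s|\<mu>. (MAX j\<in>{..<n}. a j * g (t j) s) powr \<alpha>)"
  have "0 \<le> I" unfolding I_def by (intro Bochner_Integration.integral_nonneg) auto
  show "\<exists>\<sigma>\<ge>0. \<forall>x>0. measure P {w \<in> space P. (MAX j\<in>{..<n}. a j * Y (t j) w) \<le> x} =
          exp (- (\<sigma> powr \<alpha> * x powr (- \<alpha>)))"
  proof (intro exI conjI allI impI)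
    fix x :: real assume x: "0 < x"
    have "{w \<in> space P. (MAX j\<in>{..<n}. a j * Y (t j) w) \<le> x} = {w \<in> space P. \<forall>j<n. Y (t j) w \<le> x / a j}"
      using n a by (auto simp: Max_le_iff field_simps lessThan_empty_iff)
    also have "measure P \<dots> = exp (- (LINT s|\<mu>. (MAX j\<in>{..<n}. g (t j) s / (x / a j)) powr \<alpha>))"
      using fdd[unfolded eq_fdd_extremal_integrals_def, rule_format, of n "\<lambda>j. x / a j" t] n a x by simp
    also have "(LINT s|\<mu>. (MAX j\<in>{..<n}. g (t j) s / (x / a j)) powr \<alpha>) =
        (LINT s|\<mu>. x powr (- \<alpha>) * (MAX j\<in>{..<n}. a j * g (t j) s) powr \<alpha>)"
    proof (intro Bochner_Integration.integral_cong refl)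
      fix s assume s: "s \<in> space \<mu>"
      have "0 \<le> a 0 * g (t 0) s" using L_space_nonnegD(2)[OF g s] a n by auto
      also have "\<dots> \<le> (MAX j\<in>{..<n}. a j * g (t j) s)" using n by (intro Max_ge) auto
      finally have M: "0 \<le> (MAX j\<in>{..<n}. a j * g (t j) s)" .
      have "(MAX j\<in>{..<n}. g (t j) s / (x / a j)) = (MAX j\<in>{..<n}. (a j * g (t j) s) / x)"
        by (simp add: mult.commute)
      also have "\<dots> = (MAX j\<in>{..<n}. a j * g (t j) s) / x" by (rule MAX_divide[OF n x])
      finally have eq: "(MAX j\<in>{..<n}. g (t j) s / (x / a j)) = (MAX j\<in>{..<n}. a j * g (t j) s) / x" .
      show "(MAX j\<in>{..<n}. g (t j) s / (x / a j)) powr \<alpha> = x powr (- \<alpha>) * (MAX j\<in>{..<n}. a j * g (t j) s) powr \<alpha>"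
        unfolding eq using M x by (simp add: powr_divide powr_minus field_simps)
    qed
    also have "\<dots> = x powr (- \<alpha>) * I" by (simp add: I_def)
    also have "\<dots> = (I powr (1 / \<alpha>)) powr \<alpha> * x powr (- \<alpha>)"
      using \<alpha> \<open>0 \<le> I\<close> by (simp add: powr_powr)
    finally show "measure P {w \<in> space P. (MAX j\<in>{..<n}. a j * Y (t j) w) \<le> x} =
        exp (- ((I powr (1 / \<alpha>)) powr \<alpha> * x powr (- \<alpha>)))" .
  qed simp
qed (use process in auto)

text \<open>
A finite Poisson process with intensity the probability measure \<open>B\<close>: a Poisson number \<open>n\<close> together with
an infinite sequence of independent points, of which only those with index below \<open>n\<close> are counted.
\<close>

definition poisson_points :: "'s measure \<Rightarrow> (nat \<times> (nat \<Rightarrow> 's)) measure" where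
  "poisson_points B = measure_pmf (poisson_pmf 1) \<Otimes>\<^sub>M (\<Pi>\<^sub>M i\<in>(UNIV::nat set). B)"

lemma prob_space_poisson_points:
  assumes "prob_space B"
  shows "prob_space (poisson_points B)"
  unfolding poisson_points_def
  by (intro prob_space_pair measure_pmf.prob_space_axioms prob_space_PiM assms)

text \<open>
The void probability of a Poisson process: conditionally on \<open>n\<close> points the probability is \<open>p\<^sup>n\<close>, where
\<open>p = measure B A\<close>, and \<open>\<Sum> e\<^bsup>-1\<^esup> p\<^sup>n / n! = exp (p - 1)\<close>.
\<close>

lemma measure_poisson_points_all_in:
  assumes B: "prob_space B" and A [measurable]: "A \<in> sets B"
  shows "measure (poisson_points B) {c \<in> space (poisson_points B). \<forall>i<fst c. snd c i \<in> A} = exp (measure B A - 1)"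
proof -
  interpret B: prob_space B by fact
  interpret product_prob_space "\<lambda>_. B" "UNIV :: nat set" ..
  let ?P = "\<Pi>\<^sub>M i\<in>(UNIV::nat set). B"
  interpret C: prob_space "poisson_points B" by (rule prob_space_poisson_points[OF B])
  define E where "E = {c \<in> space (poisson_points B). \<forall>i<fst c. snd c i \<in> A}"
  define p where "p = measure B A"
  have E [measurable]: "E \<in> sets (measure_pmf (poisson_pmf 1) \<Otimes>\<^sub>M ?P)"
    unfolding E_def poisson_points_def by measurable
  have sect: "emeasure ?P (Pair n -` E) = ennreal (p ^ n)" for n
  proof -
    have "Pair n -` E = {x \<in> space ?P. \<forall>i\<in>{..<n}. x i \<in> A}"
      by (auto simp: E_def poisson_points_def space_pair_measure)
    also have "emeasure ?P \<dots> = (\<Prod>i<n. emeasure B A)"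
      by (rule emeasure_PiM_Collect) auto
    finally show ?thesis by (simp add: B.emeasure_eq_measure p_def ennreal_power)
  qed
  have sums: "(\<lambda>n. 1 / fact n * exp (- 1) * p ^ n) sums (exp p * exp (- 1))"
    using sums_mult2[OF exp_converges[of p], of "exp (- 1)"] by (simp add: field_simps)
  have "emeasure (poisson_points B) E = (\<integral>\<^sup>+n. emeasure ?P (Pair n -` E) \<partial>measure_pmf (poisson_pmf 1))"
    unfolding poisson_points_def by (rule P.emeasure_pair_measure_alt) (rule E)
  also have "\<dots> = (\<integral>\<^sup>+n. ennreal (1 / fact n * exp (- 1) * p ^ n) \<partial>count_space UNIV)"
    unfolding sect nn_integral_measure_pmf
    by (intro nn_integral_cong) (simp add: ennreal_mult[symmetric] p_def)
  also have "\<dots> = (\<Sum>n. ennreal (1 / fact n * exp (- 1) * p ^ n))"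
    by (rule nn_integral_count_space_nat)
  also have "\<dots> = ennreal (exp p * exp (- 1))"
    using sums by (intro suminf_ennreal_eq) (auto simp: p_def)
  also have "exp p * exp (- 1) = exp (p - 1)" by (simp add: exp_add[symmetric])
  finally show ?thesis
    by (simp add: E_def[symmetric] p_def C.emeasure_eq_measure)
qed

text \<open>
The length of \<open>[0, x] \<inter> [0, 1]\<close>; thus \<open>clamp01 (y - m)\<close> is the length of \<open>[0, y] \<inter> [m, m + 1]\<close>.
\<close>

definition clamp01 :: "real \<Rightarrow> real" where
  "clamp01 x = min 1 (max 0 x)"

lemma sum_clamp01:
  assumes "0 \<le> y"
  shows "(\<Sum>m<n. clamp01 (y - real m)) = min (real n) y"
proof (induction n)
  case (Suc n)
  then show ?case by (auto simp: clamp01_def min_def max_def)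
qed (use assms in simp)

lemma measure_uniform_ge:
  "measure (uniform_measure lborel {0<..<1::real}) {u. y \<le> u} = 1 - clamp01 y"
proof -
  have "emeasure lborel ({0<..<1} \<inter> {u. y \<le> u}) = ennreal (1 - clamp01 y)"
  proof -
    consider "y \<le> 0" | "0 < y" "y < 1" | "1 \<le> y" by linarith
    then show ?thesis
    proof cases
      case 1
      then have "{0<..<1} \<inter> {u. y \<le> u} = {0<..<1}" by auto
      then show ?thesis using 1 by (simp add: clamp01_def)
    next
      case 2
      then have "{0<..<1} \<inter> {u. y \<le> u} = {y..<1}" by auto
      then show ?thesis using 2 by (simp add: clamp01_def)
    next
      case 3
      then have "{0<..<1} \<inter> {u. y \<le> u} = {}" by auto
      then show ?thesis using 3 by (simp add: clamp01_def)
    qed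
  qed
  then show ?thesis
    by (simp add: measure_def divide_ennreal_def) (simp add: clamp01_def)
qed

text \<open>
With \<open>S\<close> the space of \<open>D\<close>, the Poisson process on \<open>S \<times> [0, \<infinity>)\<close> with intensity \<open>D\<close> times Lebesgue measure is assembled from
independent Poisson processes on the slabs \<open>S \<times> [m, m + 1]\<close>. Each slab has mass one, and the product of
the void probabilities over the slabs replaces any computation with the joint law of arrival times. A
point \<open>(s, u)\<close> of slab number \<open>m\<close> stands for \<open>(s, m + u)\<close>.
\<close>

locale de_haan_representation =
  fixes \<alpha> :: real and D :: "'s measure" and k :: "'t \<Rightarrow> 's \<Rightarrow> real"
  assumes exponent: "0 < \<alpha>" and D: "prob_space D" and k: "\<And>t. k t \<in> L_space_nonneg \<alpha> D"
begin

sublocale D: prob_space D by (rule D)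

definition U :: "real measure" where "U = uniform_measure lborel {0<..<1}"

definition block :: "(nat \<times> (nat \<Rightarrow> 's \<times> real)) measure" where
  "block = poisson_points (D \<Otimes>\<^sub>M U)"

definition \<Omega> :: "(nat \<Rightarrow> nat \<times> (nat \<Rightarrow> 's \<times> real)) measure" where
  "\<Omega> = (\<Pi>\<^sub>M m\<in>(UNIV::nat set). block)"

definition peak :: "'t \<Rightarrow> nat \<Rightarrow> 's \<times> real \<Rightarrow> real" where
  "peak t m z = k t (fst z) / (real m + snd z) powr (1 / \<alpha>)"

text \<open>
The supremum is taken in the extended half-line; it is finite almost surely, but not everywhere.
\<close>

definition Z :: "'t \<Rightarrow> (nat \<Rightarrow> nat \<times> (nat \<Rightarrow> 's \<times> real)) \<Rightarrow> ennreal" where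
  "Z t \<omega> = (SUP m. SUP i. if i < fst (\<omega> m) then ennreal (peak t m (snd (\<omega> m) i)) else 0)"

lemma measurable_k [measurable]: "k t \<in> borel_measurable D"
  using L_space_measurable[OF L_space_nonnegD(1)[OF k]] .

lemma sets_U [measurable_cong]: "sets U = sets borel"
  by (simp add: U_def)

lemma prob_space_U: "prob_space U"
  unfolding U_def by (rule prob_space_uniform_measure) auto

sublocale U: prob_space U by (rule prob_space_U)

lemma prob_space_point: "prob_space (D \<Otimes>\<^sub>M U)"
  by (intro prob_space_pair D prob_space_U)

sublocale block: prob_space block
  unfolding block_def by (rule prob_space_poisson_points[OF prob_space_point])

sublocale \<Omega>: sequence_space block ..

lemma prob_space_\<Omega>: "prob_space \<Omega>"
  unfolding \<Omega>_def by (rule prob_space_PiM) (rule block.prob_space_axioms)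

lemma measurable_peak [measurable]: "peak t m \<in> borel_measurable (D \<Otimes>\<^sub>M U)"
  unfolding peak_def by measurable

lemma measurable_fst_block [measurable]: "fst \<in> block \<rightarrow>\<^sub>M count_space UNIV"
  unfolding block_def poisson_points_def by measurable

lemma measurable_point_block [measurable]: "(\<lambda>c. snd c i) \<in> block \<rightarrow>\<^sub>M D \<Otimes>\<^sub>M U"
  unfolding block_def poisson_points_def by measurable

lemma measurable_Z [measurable]: "Z t \<in> borel_measurable \<Omega>"
  unfolding Z_def \<Omega>_def by measurable

definition scale :: "nat \<Rightarrow> (nat \<Rightarrow> real) \<Rightarrow> (nat \<Rightarrow> 't) \<Rightarrow> 's \<Rightarrow> real" where
  "scale n a t s = (MAX j\<in>{..<n}. k (t j) s / a j) powr \<alpha>"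

lemma measurable_scale [measurable]: "scale n a t \<in> borel_measurable D"
  unfolding scale_def by measurable

lemma integrable_scale:
  assumes n: "0 < n" and a: "\<And>j. j < n \<Longrightarrow> 0 < a j"
  shows "integrable D (scale n a t)"
proof -
  have "integrable D (\<lambda>s. \<Sum>j<n. \<bar>(1 / a j) * k (t j) s\<bar> powr \<alpha>)"
    by (intro Bochner_Integration.integrable_sum L_space_integrable L_space_cmult L_space_nonnegD(1)[OF k])
  then show ?thesis
  proof (rule Bochner_Integration.integrable_bound)
    have "norm (scale n a t s) \<le> norm (\<Sum>j<n. \<bar>(1 / a j) * k (t j) s\<bar> powr \<alpha>)" if "s \<in> space D" for s
    proof -
      have "(MAX j\<in>{..<n}. k (t j) s / a j) \<in> (\<lambda>j. k (t j) s / a j) ` {..<n}"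
        using n by (intro Max_in) auto
      then obtain j where j: "j < n" "(MAX j\<in>{..<n}. k (t j) s / a j) = k (t j) s / a j" by auto
      have "scale n a t s \<le> \<bar>(1 / a j) * k (t j) s\<bar> powr \<alpha>"
        unfolding scale_def j(2) using exponent a[OF j(1)] L_space_nonnegD(2)[OF k that, of "t j"]
        by (intro powr_mono2) auto
      also have "\<dots> \<le> (\<Sum>j<n. \<bar>(1 / a j) * k (t j) s\<bar> powr \<alpha>)"
        using j(1) by (intro member_le_sum) auto
      finally show ?thesis by (simp add: scale_def sum_nonneg)
    qed
    then show "AE s in D. norm (scale n a t s) \<le> norm (\<Sum>j<n. \<bar>(1 / a j) * k (t j) s\<bar> powr \<alpha>)"
      by (rule AE_I2)
  qed measurable
qed

definition below :: "nat \<Rightarrow> (nat \<Rightarrow> real) \<Rightarrow> (nat \<Rightarrow> 't) \<Rightarrow> nat \<Rightarrow> ('s \<times> real) set" where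
  "below n a t m = {z \<in> space (D \<Otimes>\<^sub>M U). \<forall>j<n. peak (t j) m z \<le> a j}"

text \<open>
Raised to the power \<open>\<alpha>\<close>, the conditions \<open>k s / r \<le> a\<close> on a point at height \<open>r\<^sup>\<alpha> = m + u\<close> say that the point
lies on or above the graph of \<open>scale n a t\<close>. The restriction to \<open>0 < u\<close>, which holds almost surely, keeps the
denominator away from zero in slab \<open>0\<close>.
\<close>

lemma below_iff:
  assumes n: "0 < n" and a: "\<And>j. j < n \<Longrightarrow> 0 < a j" and s: "s \<in> space D" and u: "0 < u"
  shows "(s, u) \<in> below n a t m \<longleftrightarrow> scale n a t s \<le> real m + u"
proof -
  define r where "r = (real m + u) powr (1 / \<alpha>)"
  have r: "0 < r" "r powr \<alpha> = real m + u" using u exponent by (auto simp: r_def powr_powr)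
  have "(s, u) \<in> below n a t m \<longleftrightarrow> (\<forall>j<n. k (t j) s / r \<le> a j)"
    using s by (simp add: below_def peak_def r_def space_pair_measure U_def)
  also have "\<dots> \<longleftrightarrow> (\<forall>j<n. k (t j) s / a j \<le> r)"
    using a r by (simp add: field_simps)
  also have "\<dots> \<longleftrightarrow> (MAX j\<in>{..<n}. k (t j) s / a j) \<le> r"
    using n by (auto simp: lessThan_empty_iff)
  also have "\<dots> \<longleftrightarrow> scale n a t s \<le> r powr \<alpha>"
  proof -
    have "0 \<le> k (t 0) s / a 0" using L_space_nonnegD(2)[OF k s] a[OF n] by simp
    also have "\<dots> \<le> (MAX j\<in>{..<n}. k (t j) s / a j)" using n by (intro Max_ge) auto
    finally show ?thesis
      unfolding scale_def using r(1) exponent powr_mono2[of \<alpha> _ r] powr_less_mono2[of \<alpha> r]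
      by (meson less_imp_le not_le)
  qed
  finally show ?thesis by (simp add: r)
qed

lemma below_sets [measurable]: "below n a t m \<in> sets (D \<Otimes>\<^sub>M U)"
  unfolding below_def by measurable

text \<open>
By Fubini: over \<open>s\<close>, the part of the slab under the graph of \<open>scale n a t\<close> has length
\<open>clamp01 (scale n a t s - m)\<close>.
\<close>

lemma measure_below:
  assumes n: "0 < n" and a: "\<And>j. j < n \<Longrightarrow> 0 < a j"
  shows "measure (D \<Otimes>\<^sub>M U) (below n a t m) = 1 - (LINT s|D. clamp01 (scale n a t s - real m))"
proof -
  interpret DU: prob_space "D \<Otimes>\<^sub>M U" by (rule prob_space_point)
  have [measurable]: "clamp01 \<in> borel_measurable borel" unfolding clamp01_def by measurable
  have int: "integrable D (\<lambda>s. clamp01 (scale n a t s - real m))"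
    by (rule D.integrable_const_bound[where B=1]) (auto simp: clamp01_def)
  have sect: "emeasure U (Pair s -` below n a t m) = ennreal (1 - clamp01 (scale n a t s - real m))"
    if s: "s \<in> space D" for s
  proof -
    have "AE u in U. 0 < u"
      unfolding U_def by (rule AE_uniform_measureI) auto
    then have "emeasure U (Pair s -` below n a t m) = emeasure U {u. scale n a t s - real m \<le> u}"
    proof (intro emeasure_eq_AE)
      show "AE u in U. (u \<in> Pair s -` below n a t m) = (u \<in> {u. scale n a t s - real m \<le> u})"
        using \<open>AE u in U. 0 < u\<close> by eventually_elim (use below_iff[OF n a s] in auto)
      show "Pair s -` below n a t m \<in> sets U" by (rule sets_Pair1[OF below_sets])
      show "{u. scale n a t s - real m \<le> u} \<in> sets U" unfolding sets_U by measurable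
    qed
    also have "\<dots> = ennreal (1 - clamp01 (scale n a t s - real m))"
      unfolding U.emeasure_eq_measure unfolding U_def by (simp add: measure_uniform_ge)
    finally show ?thesis .
  qed
  have "emeasure (D \<Otimes>\<^sub>M U) (below n a t m) = (\<integral>\<^sup>+s. emeasure U (Pair s -` below n a t m) \<partial>D)"
    by (rule U.emeasure_pair_measure_alt) (rule below_sets)
  also have "\<dots> = (\<integral>\<^sup>+s. ennreal (1 - clamp01 (scale n a t s - real m)) \<partial>D)"
    by (intro nn_integral_cong sect)
  also have "\<dots> = ennreal (LINT s|D. 1 - clamp01 (scale n a t s - real m))"
    using int by (intro nn_integral_eq_integral) (auto simp: clamp01_def)
  also have "(LINT s|D. 1 - clamp01 (scale n a t s - real m)) = 1 - (LINT s|D. clamp01 (scale n a t s - real m))"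
    using int by (simp add: D.prob_space)
  finally have *: "emeasure (D \<Otimes>\<^sub>M U) (below n a t m) = ennreal (1 - (LINT s|D. clamp01 (scale n a t s - real m)))" .
  have "(LINT s|D. clamp01 (scale n a t s - real m)) \<le> (LINT s|D. 1)"
    using int by (intro integral_mono) (auto simp: clamp01_def)
  then show ?thesis
    using * by (intro measure_eq_emeasure_eq_ennreal) (auto simp: D.prob_space)
qed

lemma Z_le_iff:
  assumes "\<omega> \<in> space \<Omega>" and a: "\<And>j. j < n \<Longrightarrow> 0 < a j"
  shows "(\<forall>j<n. Z (t j) \<omega> \<le> ennreal (a j)) \<longleftrightarrow>
    (\<forall>m. \<omega> m \<in> {c \<in> space block. \<forall>i<fst c. snd c i \<in> below n a t m})"
proof -
  have \<omega>: "\<omega> m \<in> space block" for m using assms(1) by (auto simp: \<Omega>_def space_PiM)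
  have pt: "snd (\<omega> m) i \<in> space (D \<Otimes>\<^sub>M U)" for m i
    using measurable_space[OF measurable_point_block \<omega>] .
  have "(\<forall>j<n. Z (t j) \<omega> \<le> ennreal (a j)) \<longleftrightarrow>
    (\<forall>j<n. \<forall>m. \<forall>i<fst (\<omega> m). ennreal (peak (t j) m (snd (\<omega> m) i)) \<le> ennreal (a j))"
    unfolding Z_def SUP_le_iff by auto
  also have "\<dots> \<longleftrightarrow> (\<forall>j<n. \<forall>m. \<forall>i<fst (\<omega> m). peak (t j) m (snd (\<omega> m) i) \<le> a j)"
    using a by (auto simp: ennreal_le_iff less_imp_le)
  also have "\<dots> \<longleftrightarrow> (\<forall>m. \<omega> m \<in> {c \<in> space block. \<forall>i<fst c. snd c i \<in> below n a t m})"
    using \<omega> pt by (auto simp: below_def)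
  finally show ?thesis .
qed

text \<open>
The event says that the Poisson process has no point below the graph of \<open>F = scale n a t\<close>, so its
probability is \<open>exp\<close> of minus the area below the graph. The area is collected slab by slab: the first \<open>i\<close>
slabs contain \<open>\<integral> min i F dD\<close>, which tends to \<open>\<integral> F dD\<close>.
\<close>

lemma prob_Z_le:
  assumes n: "0 < n" and a: "\<And>j. j < n \<Longrightarrow> 0 < a j"
  shows "measure \<Omega> {\<omega> \<in> space \<Omega>. \<forall>j<n. Z (t j) \<omega> \<le> ennreal (a j)} = exp (- (LINT s|D. scale n a t s))"
proof -
  define F where "F = scale n a t"
  define E where "E m = {c \<in> space block. \<forall>i<fst c. snd c i \<in> below n a t m}" for m
  have int: "integrable D F" unfolding F_def by (rule integrable_scale[OF n a])
  have F [measurable]: "F \<in> borel_measurable D" and F_nonneg: "0 \<le> F s" for s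
    by (auto simp: F_def scale_def[abs_def])
  have [measurable]: "clamp01 \<in> borel_measurable borel" unfolding clamp01_def by measurable
  have E_sets: "E m \<in> sets block" for m unfolding E_def by measurable
  have E: "measure block (E m) = exp (- (LINT s|D. clamp01 (F s - real m)))" for m
    unfolding E_def block_def measure_poisson_points_all_in[OF prob_space_point below_sets]
    by (simp add: measure_below[OF n a] F_def)
  have int_clamp: "integrable D (\<lambda>s. clamp01 (F s - real m))" for m
    by (rule D.integrable_const_bound[where B=1]) (auto simp: clamp01_def)
  have "(\<Prod>m\<le>i. measure block (E m)) = exp (- (LINT s|D. min (real (Suc i)) (F s)))" for i
  proof -
    have "(\<Prod>m\<le>i. measure block (E m)) = exp (- (\<Sum>m<Suc i. (LINT s|D. clamp01 (F s - real m))))"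
      unfolding E by (simp add: exp_sum sum_negf[symmetric] lessThan_Suc_atMost)
    also have "(\<Sum>m<Suc i. (LINT s|D. clamp01 (F s - real m))) = (LINT s|D. (\<Sum>m<Suc i. clamp01 (F s - real m)))"
      using int_clamp by (intro Bochner_Integration.integral_sum[symmetric]) auto
    finally show ?thesis unfolding sum_clamp01[OF F_nonneg] .
  qed
  then have lim1: "(\<lambda>i. exp (- (LINT s|D. min (real (Suc i)) (F s)))) \<longlonglongrightarrow> measure \<Omega> (Pi UNIV E)"
    using \<Omega>.measure_PiM_countable[of E, OF E_sets] by (simp add: \<Omega>_def)
  have "(\<lambda>i. LINT s|D. min (real (Suc i)) (F s)) \<longlonglongrightarrow> (LINT s|D. F s)"
  proof (rule integral_dominated_convergence[where w=F])
    show "AE s in D. (\<lambda>i. min (real (Suc i)) (F s)) \<longlonglongrightarrow> F s"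
    proof (rule AE_I2)
      fix s
      obtain i0 where i0: "F s \<le> real i0" using real_arch_simple by blast
      have "\<forall>\<^sub>F i in sequentially. min (real (Suc i)) (F s) = F s"
        using eventually_ge_at_top[of i0] by eventually_elim (use i0 in simp)
      then show "(\<lambda>i. min (real (Suc i)) (F s)) \<longlonglongrightarrow> F s" by (rule tendsto_eventually)
    qed
    show "AE s in D. norm (min (real (Suc i)) (F s)) \<le> F s" for i
      using F_nonneg by (auto simp: min_def)
  qed (use int in measurable)
  then have "(\<lambda>i. exp (- (LINT s|D. min (real (Suc i)) (F s)))) \<longlonglongrightarrow> exp (- (LINT s|D. F s))"
    by (intro tendsto_intros)
  with lim1 have "measure \<Omega> (Pi UNIV E) = exp (- (LINT s|D. F s))" by (rule LIMSEQ_unique)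
  also have "Pi UNIV E = {\<omega> \<in> space \<Omega>. \<forall>j<n. Z (t j) \<omega> \<le> ennreal (a j)}"
  proof (intro set_eqI)
    fix \<omega>
    have "\<omega> \<in> space \<Omega>" if "\<omega> \<in> Pi UNIV E"
      using that by (auto simp: E_def \<Omega>_def space_PiM PiE_def Pi_iff)
    then show "\<omega> \<in> Pi UNIV E \<longleftrightarrow> \<omega> \<in> {\<omega> \<in> space \<Omega>. \<forall>j<n. Z (t j) \<omega> \<le> ennreal (a j)}"
      using Z_le_iff[of \<omega> n a t, OF _ a] by (auto simp: E_def Pi_iff)
  qed
  finally show ?thesis by (simp add: F_def)
qed

text \<open>
By the previous lemma with one index, \<open>Z t \<le> a\<close> has probability \<open>exp (- c a\<^bsup>-\<alpha>\<^esup>)\<close>, which tends to one as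
\<open>a\<close> grows.
\<close>

lemma AE_Z_finite: "AE \<omega> in \<Omega>. Z t \<omega> < \<infinity>"
proof -
  interpret \<Omega>: prob_space \<Omega> by (rule prob_space_\<Omega>)
  define c where "c = (LINT s|D. k t s powr \<alpha>)"
  have ge: "exp (- (c * real (Suc i) powr (- \<alpha>))) \<le> measure \<Omega> {\<omega> \<in> space \<Omega>. Z t \<omega> < \<infinity>}" for i
  proof -
    have "scale 1 (\<lambda>_. real (Suc i)) (\<lambda>_. t) s = k t s powr \<alpha> * real (Suc i) powr (- \<alpha>)"
      if "s \<in> space D" for s
      using L_space_nonnegD(2)[OF k that, of t]
      by (simp add: scale_def lessThan_Suc powr_divide powr_minus field_simps)
    then have "(LINT s|D. scale 1 (\<lambda>_. real (Suc i)) (\<lambda>_. t) s) = c * real (Suc i) powr (- \<alpha>)"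
      unfolding c_def by (subst Bochner_Integration.integral_cong[OF refl]) auto
    then have "exp (- (c * real (Suc i) powr (- \<alpha>))) = measure \<Omega> {\<omega> \<in> space \<Omega>. \<forall>j<1::nat. Z t \<omega> \<le> ennreal (real (Suc i))}"
      using prob_Z_le[of 1 "\<lambda>_. real (Suc i)" "\<lambda>_. t"] by simp
    also have "\<dots> \<le> measure \<Omega> {\<omega> \<in> space \<Omega>. Z t \<omega> < \<infinity>}"
      by (intro \<Omega>.finite_measure_mono) (auto intro: le_less_trans)
    finally show ?thesis .
  qed
  have "(\<lambda>i. real (Suc i) powr (- \<alpha>)) \<longlonglongrightarrow> 0"
    using exponent
    by (intro tendsto_neg_powr filterlim_compose[OF filterlim_real_sequentially filterlim_Suc]) auto
  then have "(\<lambda>i. exp (- (c * real (Suc i) powr (- \<alpha>)))) \<longlonglongrightarrow> exp (- (c * 0))"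
    by (intro tendsto_intros)
  then have "1 \<le> measure \<Omega> {\<omega> \<in> space \<Omega>. Z t \<omega> < \<infinity>}"
    using ge by (intro LIMSEQ_le_const2) auto
  then have "measure \<Omega> {\<omega> \<in> space \<Omega>. Z t \<omega> < \<infinity>} = 1"
    using \<Omega>.prob_le_1 by (rule antisym[rotated])
  then have "AE \<omega> in \<Omega>. \<omega> \<in> {\<omega> \<in> space \<Omega>. Z t \<omega> < \<infinity>}" by (rule \<Omega>.AE_prob_1)
  then show ?thesis by eventually_elim simp
qed

lemma prob_enn2real_Z_le:
  assumes n: "0 < n" and a: "\<And>j. j < n \<Longrightarrow> 0 < a j"
  shows "measure \<Omega> {\<omega> \<in> space \<Omega>. \<forall>j<n. enn2real (Z (t j) \<omega>) \<le> a j} = exp (- (LINT s|D. scale n a t s))"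
proof -
  interpret \<Omega>: prob_space \<Omega> by (rule prob_space_\<Omega>)
  have "AE \<omega> in \<Omega>. \<forall>j. Z (t j) \<omega> < \<infinity>"
    using AE_Z_finite by (subst AE_all_countable) auto
  then have "measure \<Omega> {\<omega> \<in> space \<Omega>. \<forall>j<n. enn2real (Z (t j) \<omega>) \<le> a j} =
    measure \<Omega> {\<omega> \<in> space \<Omega>. \<forall>j<n. Z (t j) \<omega> \<le> ennreal (a j)}"
  proof (intro \<Omega>.finite_measure_eq_AE)
    show "AE \<omega> in \<Omega>. (\<omega> \<in> {\<omega> \<in> space \<Omega>. \<forall>j<n. enn2real (Z (t j) \<omega>) \<le> a j}) =
        (\<omega> \<in> {\<omega> \<in> space \<Omega>. \<forall>j<n. Z (t j) \<omega> \<le> ennreal (a j)})"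
      using \<open>AE \<omega> in \<Omega>. \<forall>j. Z (t j) \<omega> < \<infinity>\<close>
    proof eventually_elim
      case (elim \<omega>)
      have "enn2real (Z (t j) \<omega>) \<le> a j \<longleftrightarrow> Z (t j) \<omega> \<le> ennreal (a j)" if "j < n" for j
        using elim[rule_format, of j] a[OF that]
        by (cases "Z (t j) \<omega>") (auto simp: ennreal_le_iff less_imp_le)
      then show ?case by auto
    qed
  qed measurable
  then show ?thesis by (simp add: prob_Z_le[OF n a])
qed

end

lemma frechet_process_exists:
  fixes k :: "'t \<Rightarrow> 's \<Rightarrow> real" and D :: "'s measure"
  assumes \<alpha>: "0 < \<alpha>" and D: "prob_space D" and k: "\<And>t. k t \<in> L_space_nonneg \<alpha> D"
  obtains Q :: "('t \<Rightarrow> real) measure" and Y :: "'t \<Rightarrow> ('t \<Rightarrow> real) \<Rightarrow> real" where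
    "frechet_process \<alpha> Q Y" "eq_fdd_extremal_integrals \<alpha> Q Y D k"
proof -
  interpret de_haan_representation \<alpha> D k by (rule de_haan_representation.intro) fact+
  interpret \<Omega>: prob_space \<Omega> by (rule prob_space_\<Omega>)
  let ?P = "\<Pi>\<^sub>M t\<in>(UNIV::'t set). (borel :: real measure)"
  define path where "path \<omega> t = enn2real (Z t \<omega>)" for \<omega> t
  have [measurable]: "path \<in> \<Omega> \<rightarrow>\<^sub>M ?P"
    unfolding path_def by (intro measurable_PiM_single') (auto simp: space_PiM)
  define Q where "Q = distr \<Omega> ?P path"
  define Y :: "'t \<Rightarrow> ('t \<Rightarrow> real) \<Rightarrow> real" where "Y t \<omega> = \<omega> t" for t \<omega>
  have sets_Q [measurable_cong]: "sets Q = sets ?P" by (simp add: Q_def)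
  have [measurable]: "Y t \<in> borel_measurable ?P" for t unfolding Y_def by measurable
  have fdd: "eq_fdd_extremal_integrals \<alpha> Q Y D k"
    unfolding eq_fdd_extremal_integrals_def
  proof (intro allI impI)
    fix n :: nat and a :: "nat \<Rightarrow> real" and t
    assume n: "0 < n" and a: "\<forall>j<n. 0 < a j"
    have "measure Q {w \<in> space Q. \<forall>j<n. Y (t j) w \<le> a j} =
      measure \<Omega> (path -` {w \<in> space ?P. \<forall>j<n. Y (t j) w \<le> a j} \<inter> space \<Omega>)"
      unfolding Q_def space_distr by (rule measure_distr) measurable
    also have "path -` {w \<in> space ?P. \<forall>j<n. Y (t j) w \<le> a j} \<inter> space \<Omega> =
      {\<omega> \<in> space \<Omega>. \<forall>j<n. enn2real (Z (t j) \<omega>) \<le> a j}"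
      by (auto simp: Y_def path_def space_PiM)
    finally show "measure Q {w \<in> space Q. \<forall>j<n. Y (t j) w \<le> a j} =
        exp (- (LINT s|D. (MAX j\<in>{..<n}. k (t j) s / a j) powr \<alpha>))"
      using prob_enn2real_Z_le[OF n, of a t] a by (simp add: scale_def)
  qed
  have "prob_space Q" unfolding Q_def by (rule \<Omega>.prob_space_distr) measurable
  then have "real_process Q Y" unfolding real_process_def by simp
  moreover have "AE w in Q. 0 \<le> Y t w" for t
    unfolding Q_def by (subst AE_distr_iff) (auto simp: Y_def path_def)
  ultimately have "frechet_process \<alpha> Q Y"
    using frechet_process_of_extremal_integrals[OF \<alpha> _ _ k fdd] by blast
  then show thesis using that fdd by blast
qed

section \<open>The criterion for max-associability\<close>

lemma abs_sum_same_sign: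
  fixes x a :: "nat \<Rightarrow> real"
  assumes "\<And>i j. i < n \<Longrightarrow> j < n \<Longrightarrow> 0 \<le> x i * x j"
  shows "\<bar>\<Sum>j<n. a j * x j\<bar> = \<bar>\<Sum>j<n. a j * \<bar>x j\<bar>\<bar>"
proof (cases "\<exists>i<n. x i < 0")
  case True
  then obtain i where i: "i < n" "x i < 0" by blast
  have "x j \<le> 0" if "j < n" for j
    using assms[OF i(1) that] i(2) by (simp add: zero_le_mult_iff)
  then have "(\<Sum>j<n. a j * \<bar>x j\<bar>) = (\<Sum>j<n. - (a j * x j))"
    by (intro sum.cong) auto
  then show ?thesis by (simp add: sum_negf)
next
  case False
  have "0 \<le> x j" if "j < n" for j
    using that False by (meson not_less)
  then have "(\<Sum>j<n. a j * \<bar>x j\<bar>) = (\<Sum>j<n. a j * x j)"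
    by (intro sum.cong) auto
  then show ?thesis by simp
qed

text \<open>
The sign of \<open>f s * f t\<close> is read off the two-dimensional distribution at \<open>s\<close> and \<open>t\<close>; the converse
uses the Frechet process built from the functions \<open>\<bar>f t\<bar>\<close>.
\<close>

lemma max_associable_iff_same_sign:
  fixes f :: "'t \<Rightarrow> 's \<Rightarrow> real"
  assumes \<alpha>: "0 < \<alpha>" "\<alpha> < 2" and sf: "sigma_finite_measure M"
    and f: "\<And>t. f t \<in> L_space \<alpha> M"
    and sas: "sas_process \<alpha> P X" and fdd: "eq_fdd_stable_integrals \<alpha> P X M f"
  shows "max_associable \<alpha> P X \<longleftrightarrow> (\<forall>s t. AE z in M. 0 \<le> f s z * f t z)"
proof
  assume "max_associable \<alpha> P X"
  then obtain \<mu> :: "('t \<Rightarrow> real) measure" and g where \<mu>: "sigma_finite_measure \<mu>"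
    and g: "\<And>t. g t \<in> L_space_nonneg \<alpha> \<mu>" and fdd_g: "eq_fdd_stable_integrals \<alpha> P X \<mu> g"
    unfolding max_associable_def associated_def by blast
  show "\<forall>s t. AE z in M. 0 \<le> f s z * f t z"
  proof (intro allI)
    fix s t
    have "(LINT z|M. \<bar>a * f s z + b * f t z\<bar> powr \<alpha>) = (LINT z|\<mu>. \<bar>a * g s z + b * g t z\<bar> powr \<alpha>)"
      for a b
    proof -
      let ?a = "\<lambda>j::nat. if j = 0 then a else b" and ?t = "\<lambda>j::nat. if j = 0 then s else t"
      have "complex_of_real (exp (- (LINT z|M. \<bar>\<Sum>j<2. ?a j * f (?t j) z\<bar> powr \<alpha>))) =
        complex_of_real (exp (- (LINT z|\<mu>. \<bar>\<Sum>j<2. ?a j * g (?t j) z\<bar> powr \<alpha>)))"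
        by (rule trans[OF fdd[unfolded eq_fdd_stable_integrals_def, rule_format, symmetric]
              fdd_g[unfolded eq_fdd_stable_integrals_def, rule_format]])
      then have "(LINT z|M. \<bar>\<Sum>j<2. ?a j * f (?t j) z\<bar> powr \<alpha>) = (LINT z|\<mu>. \<bar>\<Sum>j<2. ?a j * g (?t j) z\<bar> powr \<alpha>)"
        by (simp only: of_real_eq_iff exp_inj_iff neg_equal_iff_equal)
      then show ?thesis by (simp add: numeral_2_eq_2 lessThan_Suc add.commute)
    qed
    then show "AE z in M. 0 \<le> f s z * f t z"
      by (rule nonneg_product_from_stable_norms[OF \<alpha> sf \<mu> f f g g])
  qed
next
  assume sign: "\<forall>s t. AE z in M. 0 \<le> f s z * f t z"
  note [measurable] = L_space_measurable[OF f]
  have abs_f: "(\<lambda>z. \<bar>f t z\<bar>) \<in> L_space_nonneg \<alpha> M" for t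
    using f[of t] by (simp add: L_space_nonneg_def L_space_def)
  obtain D :: "('t \<Rightarrow> real) measure" and g where D: "prob_space D"
    and g: "\<And>t. g t \<in> L_space_nonneg \<alpha> D"
    and norm: "\<And>(n::nat) a t. (LINT s|D. \<bar>\<Sum>j<n. a j * g (t j) s\<bar> powr \<alpha>) =
      (LINT z|M. \<bar>\<Sum>j<n. a j * \<bar>f (t j) z\<bar>\<bar> powr \<alpha>)"
    by (rule path_space_representation[where k="\<lambda>t z. \<bar>f t z\<bar>", OF \<alpha>(1) sf abs_f])
      (erule that; assumption?; simp only:)
  obtain Q :: "('t \<Rightarrow> real) measure" and Y where Y: "frechet_process \<alpha> Q Y" "eq_fdd_extremal_integrals \<alpha> Q Y D g"
    by (rule frechet_process_exists[OF \<alpha>(1) D g])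
  have "(LINT z|M. \<bar>\<Sum>j<n. a j * f (t j) z\<bar> powr \<alpha>) = (LINT s|D. \<bar>\<Sum>j<n. a j * g (t j) s\<bar> powr \<alpha>)"
    for n :: nat and a t
  proof -
    have "AE z in M. \<forall>i j. 0 \<le> f (t i) z * f (t j) z"
      using sign by (simp add: AE_all_countable)
    then have "AE z in M. \<bar>\<Sum>j<n. a j * f (t j) z\<bar> = \<bar>\<Sum>j<n. a j * \<bar>f (t j) z\<bar>\<bar>"
      by eventually_elim (intro abs_sum_same_sign, simp)
    then show ?thesis unfolding norm
      by (intro integral_cong_AE) (auto elim!: eventually_mono)
  qed
  then have "eq_fdd_stable_integrals \<alpha> P X D g"
    using fdd by (simp add: eq_fdd_stable_integrals_def)
  moreover have "sigma_finite_measure D"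
    using D by (rule prob_space_imp_sigma_finite)
  ultimately show "max_associable \<alpha> P X"
    unfolding max_associable_def associated_def using sas Y g
    by (intro exI[of _ Q] exI[of _ Y] exI[of _ D] exI[of _ g] conjI allI)
qed

section \<open>Two-valued sections\<close>

text \<open>
The right-hand side excludes a value \<open>h u\<close> strictly between \<open>h v\<close> and \<open>h w\<close>; among three distinct values
one is in the middle, so at most two occur.
\<close>

lemma two_valued_iff_no_middle_value:
  fixes h :: "real \<Rightarrow> real"
  shows "(\<exists>f c A. \<forall>u\<in>S. h u = f * indicator A u + c) \<longleftrightarrow>
    (\<forall>u\<in>S. \<forall>v\<in>S. \<forall>w\<in>S. 0 \<le> (h v - h u) * (h w - h u))"
proof
  assume "\<exists>f c A. \<forall>u\<in>S. h u = f * indicator A u + c"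
  then obtain f c A where h: "\<And>u. u \<in> S \<Longrightarrow> h u = f * indicator A u + c" by auto
  show "\<forall>u\<in>S. \<forall>v\<in>S. \<forall>w\<in>S. 0 \<le> (h v - h u) * (h w - h u)"
    by (simp add: h) (simp add: indicator_def)
next
  assume middle: "\<forall>u\<in>S. \<forall>v\<in>S. \<forall>w\<in>S. 0 \<le> (h v - h u) * (h w - h u)"
  show "\<exists>f c A. \<forall>u\<in>S. h u = f * indicator A u + c"
  proof (cases "\<exists>u\<in>S. \<exists>v\<in>S. h u \<noteq> h v")
    case True
    then obtain u v where uv: "u \<in> S" "v \<in> S" "h u \<noteq> h v" by auto
    have "h w = h u \<or> h w = h v" if "w \<in> S" for w
    proof (rule ccontr)
      assume "\<not> ?thesis"
      moreover have "0 \<le> (h v - h u) * (h w - h u)" "0 \<le> (h u - h v) * (h w - h v)"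
          "0 \<le> (h u - h w) * (h v - h w)"
        using middle uv that by auto
      ultimately show False using uv(3) unfolding zero_le_mult_iff by linarith
    qed
    then have "\<forall>w\<in>S. h w = (h v - h u) * indicator {w. h w = h v} w + h u"
      using uv by (auto simp: indicator_def)
    then show ?thesis by (intro exI)
  next
    case const: False
    show ?thesis
    proof (cases "S = {}")
      case False
      then obtain u where "u \<in> S" by auto
      then have "h w = h u" if "w \<in> S" for w
        using const that by blast
      then have "\<forall>w\<in>S. h w = 0 * indicator {} w + h u" by simp
      then show ?thesis by (intro exI)
    qed auto
  qed
qed

lemma AE_pair_shift:
  fixes \<nu> :: "'e measure"
  assumes "sigma_finite_measure \<nu>" and null: "N \<in> null_sets (\<nu> \<Otimes>\<^sub>M lborel)"
  shows "AE z in \<nu> \<Otimes>\<^sub>M lborel. (fst z, t + snd z) \<notin> (N :: ('e \<times> real) set)"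
proof -
  interpret \<nu>: sigma_finite_measure \<nu> by fact
  interpret pair_sigma_finite \<nu> lborel ..
  have [measurable]: "N \<in> sets (\<nu> \<Otimes>\<^sub>M lborel)" using null by auto
  have "AE z in \<nu> \<Otimes>\<^sub>M lborel. z \<notin> N" using null by (rule AE_not_in)
  then have "AE x in \<nu>. AE u in lborel. (x, u) \<notin> N"
    by (rule AE_pair)
  then have "AE x in \<nu>. AE u in lborel. (x, t + u) \<notin> N"
  proof (rule AE_mp[OF _ AE_I2[OF impI]])
    fix x assume [simp]: "x \<in> space \<nu>" and ae: "AE u in lborel. (x, u) \<notin> N"
    have "AE u in lborel. (x, t + 1 * u) \<notin> N"
      using ae by (intro AE_borel_affine) auto
    then show "AE u in lborel. (x, t + u) \<notin> N" by simp
  qed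
  moreover have "(\<lambda>z. (fst z, t + snd z)) \<in> \<nu> \<Otimes>\<^sub>M lborel \<rightarrow>\<^sub>M \<nu> \<Otimes>\<^sub>M lborel"
    by measurable
  then have "{z \<in> space (\<nu> \<Otimes>\<^sub>M lborel). (fst z, t + snd z) \<notin> N} \<in> sets (\<nu> \<Otimes>\<^sub>M lborel)"
    by (rule measurable_sets_Collect) measurable
  ultimately show ?thesis
    by (subst AE_pair_iff[symmetric])
qed

text \<open>
If the sign condition fails at one triple of points over \<open>x\<close>, all off \<open>N\<close>, then by continuity and closedness of
\<open>N\<close> it fails on an open neighbourhood of \<open>(x, u)\<close> inside \<open>- N\<close>, and that is not a null set. In the other
direction, almost every point and its two translates avoid \<open>N\<close>, since the measure is invariant under
translation in the second coordinate.
\<close>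

lemma two_valued_iff_increments_same_sign:
  fixes G :: "'e::metric_space \<times> real \<Rightarrow> real"
  assumes sf: "sigma_finite_measure \<nu>" and "closed N" and null: "N \<in> null_sets (\<nu> \<Otimes>\<^sub>M lborel)"
    and cont: "\<And>z. z \<in> - N \<Longrightarrow> isCont G z"
    and charges_open: "\<And>U. open U \<Longrightarrow> U \<noteq> {} \<Longrightarrow> U \<subseteq> - N \<Longrightarrow>
           \<not> (AE z in \<nu> \<Otimes>\<^sub>M lborel. z \<notin> U)"
  shows "(\<exists>(f :: 'e \<Rightarrow> real) (c :: 'e \<Rightarrow> real) (A :: 'e \<Rightarrow> real set).
       \<forall>(x, u) \<in> - N. G (x, u) = f x * indicator (A x) u + c x) \<longleftrightarrow>
    (\<forall>s t. AE (x, u) in \<nu> \<Otimes>\<^sub>M lborel. 0 \<le> (G (x, s + u) - G (x, u)) * (G (x, t + u) - G (x, u)))"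
    (is "?two \<longleftrightarrow> ?sign")
proof -
  define S where "S x = {u. (x, u) \<notin> N}" for x
  have "?two \<longleftrightarrow> (\<forall>x. \<exists>f c A. \<forall>u\<in>S x. G (x, u) = f * indicator A u + c)"
    unfolding S_def by (simp add: choice_iff Ball_def split_paired_All)
  also have "\<dots> \<longleftrightarrow> (\<forall>x. \<forall>u\<in>S x. \<forall>v\<in>S x. \<forall>w\<in>S x. 0 \<le> (G (x, v) - G (x, u)) * (G (x, w) - G (x, u)))"
    by (simp only: two_valued_iff_no_middle_value)
  also have "\<dots> \<longleftrightarrow> ?sign"
  proof
    assume pt: "\<forall>x. \<forall>u\<in>S x. \<forall>v\<in>S x. \<forall>w\<in>S x. 0 \<le> (G (x, v) - G (x, u)) * (G (x, w) - G (x, u))"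
    show ?sign
    proof (intro allI)
      fix s t
      show "AE (x, u) in \<nu> \<Otimes>\<^sub>M lborel. 0 \<le> (G (x, s + u) - G (x, u)) * (G (x, t + u) - G (x, u))"
        using AE_pair_shift[OF sf null, of s] AE_pair_shift[OF sf null, of t] AE_pair_shift[OF sf null, of 0]
      proof eventually_elim
        case (elim z)
        then show ?case
          using pt[rule_format, of "snd z" "fst z" "s + snd z" "t + snd z"] by (simp add: S_def case_prod_beta)
      qed
    qed
  next
    assume sign: ?sign
    show "\<forall>x. \<forall>u\<in>S x. \<forall>v\<in>S x. \<forall>w\<in>S x. 0 \<le> (G (x, v) - G (x, u)) * (G (x, w) - G (x, u))"
    proof (intro allI ballI, rule ccontr)
      fix x u v w
      assume S: "u \<in> S x" "v \<in> S x" "w \<in> S x"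
        and neg: "\<not> 0 \<le> (G (x, v) - G (x, u)) * (G (x, w) - G (x, u))"
      define shift where "shift r z = (fst z, r + snd z)" for r and z :: "'e \<times> real"
      define s t where "s = v - u" and "t = w - u"
      define \<Phi> where "\<Phi> z = (G (shift s z) - G z) * (G (shift t z) - G z)" for z
      have shift_cont: "isCont (shift r) z" for r z
        unfolding shift_def by (intro continuous_intros)
      have at: "shift s (x, u) = (x, v)" "shift t (x, u) = (x, w)"
        by (auto simp: shift_def s_def t_def)
      have G_shift: "isCont (\<lambda>z. G (shift r z)) (x, u)" if "shift r (x, u) \<in> - N" for r
        using shift_cont cont[OF that] by (rule isCont_o2)
      have "isCont \<Phi> (x, u)"
        unfolding \<Phi>_def using S
        by (intro continuous_mult continuous_diff G_shift cont) (auto simp: at S_def)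
      then have "(\<Phi> \<longlongrightarrow> \<Phi> (x, u)) (nhds (x, u))"
        by (simp add: continuous_at tendsto_nhds_iff)
      moreover have "\<Phi> (x, u) < 0" using neg by (simp add: \<Phi>_def at)
      ultimately have "\<forall>\<^sub>F z in nhds (x, u). \<Phi> z < 0"
        by (rule order_tendstoD)
      moreover have "\<forall>\<^sub>F z in nhds (x, u). z \<in> - N"
        using \<open>closed N\<close> S by (intro eventually_nhds_in_open) (auto simp: S_def)
      ultimately have "\<forall>\<^sub>F z in nhds (x, u). \<Phi> z < 0 \<and> z \<in> - N" by (rule eventually_conj)
      then obtain U where U: "open U" "(x, u) \<in> U" "\<And>z. z \<in> U \<Longrightarrow> \<Phi> z < 0 \<and> z \<in> - N"
        unfolding eventually_nhds by blast
      have "AE z in \<nu> \<Otimes>\<^sub>M lborel. z \<notin> U"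
        using sign[rule_format, of s t]
      proof eventually_elim
        case (elim z)
        then have "0 \<le> \<Phi> z" by (simp add: \<Phi>_def shift_def case_prod_beta)
        then show ?case using U(3)[of z] by auto
      qed
      moreover have "U \<noteq> {}" "U \<subseteq> - N" using U by auto
      ultimately show False using charges_open[OF U(1)] by blast
    qed
  qed
  finally show ?thesis .
qed

section \<open>Moving averages with continuous kernels\<close>

theorem proposition4p1:
  fixes \<alpha> :: real
    and \<nu> :: "'e::metric_space measure"
    and G :: "'e \<times> real \<Rightarrow> real"
    and P :: "'w measure"
    and X :: "real \<Rightarrow> 'w \<Rightarrow> real"
    and N :: "('e \<times> real) set"
  assumes "0 < \<alpha>" and "\<alpha> < 2"
    and "space \<nu> = UNIV" and "standard_lebesgue_space \<nu>"
    and "G \<in> borel_measurable (\<nu> \<Otimes>\<^sub>M lborel)"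
    and "\<And>t. (\<lambda>(x, u). G (x, t + u) - G (x, u)) \<in> L_space \<alpha> (\<nu> \<Otimes>\<^sub>M lborel)"
    and "sas_process \<alpha> P X"
    and "eq_fdd_stable_integrals \<alpha> P X (\<nu> \<Otimes>\<^sub>M lborel) (\<lambda>t (x, u). G (x, t + u) - G (x, u))"
    and "closed N" and "N \<in> null_sets (\<nu> \<Otimes>\<^sub>M lborel)"
    and "\<And>z. z \<in> - N \<Longrightarrow> isCont G z"
    and charges_open: "\<And>U. open U \<Longrightarrow> U \<noteq> {} \<Longrightarrow> U \<subseteq> - N \<Longrightarrow>
           \<not> (AE z in \<nu> \<Otimes>\<^sub>M lborel. z \<notin> U)"
  shows "max_associable \<alpha> P X \<longleftrightarrow>
    (\<exists>(f :: 'e \<Rightarrow> real) (c :: 'e \<Rightarrow> real) (A :: 'e \<Rightarrow> real set).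
       \<forall>(x, u) \<in> - N. G (x, u) = f x * indicator (A x) u + c x)"
proof -
  interpret \<nu>: sigma_finite_measure \<nu>
    using assms(4) by (simp add: standard_lebesgue_space_def)
  interpret pair_sigma_finite \<nu> lborel ..
  have "max_associable \<alpha> P X \<longleftrightarrow>
    (\<forall>s t. AE z in \<nu> \<Otimes>\<^sub>M lborel. 0 \<le> (case z of (x, u) \<Rightarrow> G (x, s + u) - G (x, u)) *
      (case z of (x, u) \<Rightarrow> G (x, t + u) - G (x, u)))"
    by (rule max_associable_iff_same_sign[OF assms(1,2) P.sigma_finite_measure_axioms assms(6,7,8)])
  also have "\<dots> \<longleftrightarrow>
    (\<forall>s t. AE (x, u) in \<nu> \<Otimes>\<^sub>M lborel. 0 \<le> (G (x, s + u) - G (x, u)) * (G (x, t + u) - G (x, u)))"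
    by (simp add: case_prod_beta)
  also have "\<dots> \<longleftrightarrow> (\<exists>(f :: 'e \<Rightarrow> real) (c :: 'e \<Rightarrow> real) (A :: 'e \<Rightarrow> real set).
       \<forall>(x, u) \<in> - N. G (x, u) = f x * indicator (A x) u + c x)"
    by (rule two_valued_iff_increments_same_sign[OF \<nu>.sigma_finite_measure_axioms assms(9,10,11) charges_open, symmetric])
  finally show ?thesis .
qed

end
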